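(* Suppose that $\widetilde W$ is an irreducible affine Weyl group of rank $\ge3$, with positive root system $\widetilde\Phi^+$. Let $B$ be an infinite biclosed set in $\widetilde\Phi^+$ such that $\widetilde\Phi^+\setminus B$ is also infinite. Then the $B$-twisted weak Bruhat order $(\widetilde W,\le'_B)$ has an infinite antichain, and the $B$-twisted strong Bruhat order $(\widetilde W,\le_B)$ has an infinite antichain.
   Context: Affine root system: $\Phi$ is a finite irreducible crystallographic root system in a Euclidean space $V$, with Weyl group $W$, standard positive system $\Phi^+$, $\Phi^-=-\Phi^+$, simple system $\Delta$ and highest root $\rho$. Put $V'=V\oplus\mathbb R\delta$ and extend the inner product by $(\delta,v)=0$ for all $v\in V'$. For $\alpha\in\Phi^+$ let $\{\alpha\}^\wedge=\{\alpha+n\delta\mid n\in\mathbb Z_{\ge0}\}$; for $\alpha\in\Phi^-$ let $\{\alpha\}^\wedge=\{\alpha+(n+1)\delta\mid n\in\mathbb Z_{\ge0}\}$; for $\Lambda\subset\Phi$ let $\Lambda^\wedge=\bigcup_{\alpha\in\Lambda}\{\alpha\}^\wedge$. Positive roots: $\widetilde\Phi^+=\Phi^\wedge$; all roots: $\widetilde\Phi=\Phi^\wedge\uplus-\Phi^\wedge$. $\widetilde W$ is the group generated by the reflections $s_\gamma(v)=v-2\frac{(v,\gamma)}{(\gamma,\gamma)}\gamma$, $\gamma\in\widetilde\Phi$; it is a Coxeter group with simple reflections those in the simple roots $\Delta\cup\{\delta-\rho\}$ and length function $l$; its rank is the number of simple reflections. Inversion set: $N(w)=\{\gamma\in\widetilde\Phi^+\mid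 w^{-1}(\gamma)\in-\widetilde\Phi^+\}$. Biclosed: $\Gamma\subset\widetilde\Phi$ is closed if $\alpha,\beta\in\Gamma$, $k_1,k_2\in\mathbb R_{\ge0}$, $k_1\alpha+k_2\beta\in\widetilde\Phi$ imply $k_1\alpha+k_2\beta\in\Gamma$; $B\subset\widetilde\Phi^+$ is biclosed if $B$ and $\widetilde\Phi^+\setminus B$ are both closed. (Right) twisted weak Bruhat order: $x\le'_B y$ iff $N(x)\setminus N(y)\subset B$ and $N(y)\setminus N(x)\subset\widetilde\Phi^+\setminus B$. (Left) twisted strong Bruhat order: with $l_B(w)=l(w)-2|N(w^{-1})\cap B|$, $x\le_B y$ iff $y=t_kt_{k-1}\cdots t_1x$ for some $k\ge0$ and reflections $t_i$ of $\widetilde W$ with $l_B(t_i\cdots t_1x)=l_B(t_{i-1}\cdots t_1x)+1$ for $1\le i\le k$. *)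

theory Defs
  imports "HOL-Analysis.Analysis"
begin

definition fin_reflection :: "'a::euclidean_space \<Rightarrow> 'a \<Rightarrow> 'a" where
  "fin_reflection \<alpha> v = v - (2 * (v \<bullet> \<alpha>) / (\<alpha> \<bullet> \<alpha>)) *\<^sub>R \<alpha>"

definition crystallographic_root_system :: "'a::euclidean_space set \<Rightarrow> bool" where
  "crystallographic_root_system \<Phi> \<longleftrightarrow>
     finite \<Phi> \<and> 0 \<notin> \<Phi> \<and> span \<Phi> = UNIV \<and>
     (\<forall>\<alpha>\<in>\<Phi>. {c *\<^sub>R \<alpha> | c. c *\<^sub>R \<alpha> \<in> \<Phi>} = {\<alpha>, - \<alpha>}) \<and>
     (\<forall>\<alpha>\<in>\<Phi>. fin_reflection \<alpha> ` \<Phi> = \<Phi>) \<and>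
     (\<forall>\<alpha>\<in>\<Phi>. \<forall>\<beta>\<in>\<Phi>. 2 * (\<beta> \<bullet> \<alpha>) / (\<alpha> \<bullet> \<alpha>) \<in> \<int>)"

definition irreducible_roots :: "'a::euclidean_space set \<Rightarrow> bool" where
  "irreducible_roots \<Phi> \<longleftrightarrow> \<Phi> \<noteq> {} \<and>
     \<not> (\<exists>\<Phi>1 \<Phi>2. \<Phi>1 \<noteq> {} \<and> \<Phi>2 \<noteq> {} \<and> \<Phi> = \<Phi>1 \<union> \<Phi>2 \<and> (\<forall>\<alpha>\<in>\<Phi>1. \<forall>\<beta>\<in>\<Phi>2. \<alpha> \<bullet> \<beta> = 0))"

definition nonneg_combinations :: "'a::euclidean_space set \<Rightarrow> 'a set" where
  "nonneg_combinations \<Delta> = {\<Sum>\<alpha>\<in>\<Delta>. c \<alpha> *\<^sub>R \<alpha> | c. \<forall>\<alpha>\<in>\<Delta>. 0 \<le> c \<alpha>}"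

definition simple_system :: "'a::euclidean_space set \<Rightarrow> 'a set \<Rightarrow> bool" where
  "simple_system \<Phi> \<Delta> \<longleftrightarrow> \<Delta> \<subseteq> \<Phi> \<and> independent \<Delta> \<and>
     (\<forall>\<alpha>\<in>\<Phi>. \<alpha> \<in> nonneg_combinations \<Delta> \<or> - \<alpha> \<in> nonneg_combinations \<Delta>)"

definition fin_pos :: "'a::euclidean_space set \<Rightarrow> 'a set \<Rightarrow> 'a set" where
  "fin_pos \<Phi> \<Delta> = \<Phi> \<inter> nonneg_combinations \<Delta>"

definition highest_root :: "'a::euclidean_space set \<Rightarrow> 'a set \<Rightarrow> 'a \<Rightarrow> bool" where
  "highest_root \<Phi> \<Delta> \<rho> \<longleftrightarrow> \<rho> \<in> \<Phi> \<and> (\<forall>\<alpha>\<in>\<Phi>. \<rho> - \<alpha> \<in> nonneg_combinations \<Delta>)"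

text \<open>
  The space $V' = V \oplus \mathbb R\delta$ is the type \<open>'a \<times> real\<close>, the pair \<open>(v, c)\<close>
  standing for $v + c\delta$. Its form is degenerate, with $\delta$ in the radical; it is
  not the library's inner product on the product type.
\<close>

definition aform :: "'a::euclidean_space \<times> real \<Rightarrow> 'a \<times> real \<Rightarrow> real" where
  "aform u v = fst u \<bullet> fst v"

definition reflection :: "'a::euclidean_space \<times> real \<Rightarrow> 'a \<times> real \<Rightarrow> 'a \<times> real" where
  "reflection \<gamma> v = v - (2 * aform v \<gamma> / aform \<gamma> \<gamma>) *\<^sub>R \<gamma>"

definition hat :: "'a::euclidean_space set \<Rightarrow> 'a set \<Rightarrow> 'a set \<Rightarrow> ('a \<times> real) set" where
  "hat \<Phi> \<Delta> \<Lambda> =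
     {(\<alpha>, real n) | \<alpha> n. \<alpha> \<in> \<Lambda> \<inter> fin_pos \<Phi> \<Delta>} \<union>
     {(\<alpha>, real (n + 1)) | \<alpha> n. \<alpha> \<in> \<Lambda> \<inter> uminus ` fin_pos \<Phi> \<Delta>}"

definition aff_pos :: "'a::euclidean_space set \<Rightarrow> 'a set \<Rightarrow> ('a \<times> real) set" where
  "aff_pos \<Phi> \<Delta> = hat \<Phi> \<Delta> \<Phi>"

definition aff_roots :: "'a::euclidean_space set \<Rightarrow> 'a set \<Rightarrow> ('a \<times> real) set" where
  "aff_roots \<Phi> \<Delta> = aff_pos \<Phi> \<Delta> \<union> uminus ` aff_pos \<Phi> \<Delta>"

text \<open>The simple roots are the elements of \<open>\<Delta>\<close> together with $\delta - \rho$.\<close>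

definition aff_simple_roots :: "'a::euclidean_space set \<Rightarrow> 'a \<Rightarrow> ('a \<times> real) set" where
  "aff_simple_roots \<Delta> \<rho> = (\<lambda>\<alpha>. (\<alpha>, 0)) ` \<Delta> \<union> {(- \<rho>, 1)}"

inductive_set generated_group :: "('b \<Rightarrow> 'b) set \<Rightarrow> ('b \<Rightarrow> 'b) set" for S where
  one: "id \<in> generated_group S"
| gen: "s \<in> S \<Longrightarrow> s \<in> generated_group S"
| inverse: "g \<in> generated_group S \<Longrightarrow> inv g \<in> generated_group S"
| mult: "g \<in> generated_group S \<Longrightarrow> h \<in> generated_group S \<Longrightarrow> g \<circ> h \<in> generated_group S"

definition aff_reflections ::
    "'a::euclidean_space set \<Rightarrow> 'a set \<Rightarrow> ('a \<times> real \<Rightarrow> 'a \<times> real) set" where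
  "aff_reflections \<Phi> \<Delta> = reflection ` aff_roots \<Phi> \<Delta>"

definition aff_weyl ::
    "'a::euclidean_space set \<Rightarrow> 'a set \<Rightarrow> ('a \<times> real \<Rightarrow> 'a \<times> real) set" where
  "aff_weyl \<Phi> \<Delta> = generated_group (aff_reflections \<Phi> \<Delta>)"

definition simple_reflections ::
    "'a::euclidean_space set \<Rightarrow> 'a \<Rightarrow> ('a \<times> real \<Rightarrow> 'a \<times> real) set" where
  "simple_reflections \<Delta> \<rho> = reflection ` aff_simple_roots \<Delta> \<rho>"

definition aff_rank :: "'a::euclidean_space set \<Rightarrow> 'a \<Rightarrow> nat" where
  "aff_rank \<Delta> \<rho> = card (simple_reflections \<Delta> \<rho>)"

definition aff_length ::
    "'a::euclidean_space set \<Rightarrow> 'a \<Rightarrow> ('a \<times> real \<Rightarrow> 'a \<times> real) \<Rightarrow> nat" where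
  "aff_length \<Delta> \<rho> w =
     (LEAST n. \<exists>ss. length ss = n \<and> set ss \<subseteq> simple_reflections \<Delta> \<rho> \<and> foldr (\<circ>) ss id = w)"

definition inversions :: "'a::euclidean_space set \<Rightarrow> 'a set \<Rightarrow>
    ('a \<times> real \<Rightarrow> 'a \<times> real) \<Rightarrow> ('a \<times> real) set" where
  "inversions \<Phi> \<Delta> w = {\<gamma> \<in> aff_pos \<Phi> \<Delta>. inv w \<gamma> \<in> uminus ` aff_pos \<Phi> \<Delta>}"

definition closed_roots ::
    "'a::euclidean_space set \<Rightarrow> 'a set \<Rightarrow> ('a \<times> real) set \<Rightarrow> bool" where
  "closed_roots \<Phi> \<Delta> \<Gamma> \<longleftrightarrow> \<Gamma> \<subseteq> aff_roots \<Phi> \<Delta> \<and>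
     (\<forall>\<alpha>\<in>\<Gamma>. \<forall>\<beta>\<in>\<Gamma>. \<forall>k1 k2. 0 \<le> k1 \<longrightarrow> 0 \<le> k2 \<longrightarrow>
        k1 *\<^sub>R \<alpha> + k2 *\<^sub>R \<beta> \<in> aff_roots \<Phi> \<Delta> \<longrightarrow> k1 *\<^sub>R \<alpha> + k2 *\<^sub>R \<beta> \<in> \<Gamma>)"

definition biclosed ::
    "'a::euclidean_space set \<Rightarrow> 'a set \<Rightarrow> ('a \<times> real) set \<Rightarrow> bool" where
  "biclosed \<Phi> \<Delta> B \<longleftrightarrow> B \<subseteq> aff_pos \<Phi> \<Delta> \<and>
     closed_roots \<Phi> \<Delta> B \<and> closed_roots \<Phi> \<Delta> (aff_pos \<Phi> \<Delta> - B)"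

definition twisted_weak_le :: "'a::euclidean_space set \<Rightarrow> 'a set \<Rightarrow> ('a \<times> real) set \<Rightarrow>
    ('a \<times> real \<Rightarrow> 'a \<times> real) \<Rightarrow> ('a \<times> real \<Rightarrow> 'a \<times> real) \<Rightarrow> bool" where
  "twisted_weak_le \<Phi> \<Delta> B x y \<longleftrightarrow>
     inversions \<Phi> \<Delta> x - inversions \<Phi> \<Delta> y \<subseteq> B \<and>
     inversions \<Phi> \<Delta> y - inversions \<Phi> \<Delta> x \<subseteq> aff_pos \<Phi> \<Delta> - B"

definition twisted_length :: "'a::euclidean_space set \<Rightarrow> 'a set \<Rightarrow> 'a \<Rightarrow> ('a \<times> real) set \<Rightarrow>
    ('a \<times> real \<Rightarrow> 'a \<times> real) \<Rightarrow> int" where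
  "twisted_length \<Phi> \<Delta> \<rho> B w =
     int (aff_length \<Delta> \<rho> w) - 2 * int (card (inversions \<Phi> \<Delta> (inv w) \<inter> B))"

definition twisted_strong_step :: "'a::euclidean_space set \<Rightarrow> 'a set \<Rightarrow> 'a \<Rightarrow>
    ('a \<times> real) set \<Rightarrow> ('a \<times> real \<Rightarrow> 'a \<times> real) \<Rightarrow> ('a \<times> real \<Rightarrow> 'a \<times> real) \<Rightarrow> bool" where
  "twisted_strong_step \<Phi> \<Delta> \<rho> B u v \<longleftrightarrow>
     (\<exists>t \<in> aff_reflections \<Phi> \<Delta>. v = t \<circ> u \<and>
        twisted_length \<Phi> \<Delta> \<rho> B v = twisted_length \<Phi> \<Delta> \<rho> B u + 1)"

definition twisted_strong_le :: "'a::euclidean_space set \<Rightarrow> 'a set \<Rightarrow> 'a \<Rightarrow>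
    ('a \<times> real) set \<Rightarrow> ('a \<times> real \<Rightarrow> 'a \<times> real) \<Rightarrow> ('a \<times> real \<Rightarrow> 'a \<times> real) \<Rightarrow> bool" where
  "twisted_strong_le \<Phi> \<Delta> \<rho> B = (twisted_strong_step \<Phi> \<Delta> \<rho> B)\<^sup>*\<^sup>*"

definition antichain_in :: "'b set \<Rightarrow> ('b \<Rightarrow> 'b \<Rightarrow> bool) \<Rightarrow> 'b set \<Rightarrow> bool" where
  "antichain_in P le A \<longleftrightarrow> A \<subseteq> P \<and> (\<forall>x\<in>A. \<forall>y\<in>A. x \<noteq> y \<longrightarrow> \<not> le x y)"

end

theory Submission
  imports Defs
begin

text \<open>
  Both twisted orders strictly increase a statistic. With \<open>S(w) = |N(w) - B| - |N(w) \<inter> B|\<close>, the weak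
  order strictly increases \<open>S(w)\<close>, and since \<open>l_B(w) = S(w\<inverse>)\<close> the strong order strictly increases
  \<open>S(w\<inverse>)\<close>. So it is enough to find infinitely many \<open>w\<close> with the same value of \<open>S\<close>, and by the
  pigeonhole principle infinitely many with bounded \<open>S\<close>; these are found among the translations.

  Let \<open>A\<close> be the set of the \<open>\<beta> \<in> \<Phi>\<close> such that \<open>B\<close> contains infinitely many, hence almost all,
  \<open>\<beta> + n\<delta>\<close>. Up to a bounded error, \<open>S\<close> of the translation by \<open>x\<close> is
  \<open>f x = (\<Sum>\<beta>\<in>\<Phi>. \<plusminus> max 0 (\<beta> \<bullet> x))\<close> with sign \<open>-\<close> exactly for \<open>\<beta> \<in> A\<close>. The sets \<open>A\<close> and
  \<open>\<Phi> - A\<close> are closed and nonempty, so by irreducibility \<open>U = {\<alpha> \<in> A. - \<alpha> \<notin> A}\<close> is nonempty. Its sum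
  \<open>\<lambda>\<close> is nonzero and orthogonal to all roots outside \<open>U \<union> - U\<close>, which gives
  \<open>f \<lambda> = - (\<lambda> \<bullet> \<lambda>) < 0 < f (- \<lambda>)\<close>. In dimension at least 2 the sphere is connected, so the
  positively homogeneous function \<open>f\<close> vanishes on a ray; as \<open>f\<close> is Lipschitz, it is bounded on the
  infinitely many points of the coroot lattice that lie within a bounded distance of this ray.
\<close>

section \<open>Finite root systems\<close>

locale based_root_system =
  fixes \<Phi> \<Delta> :: "'a::euclidean_space set" and \<rho> :: 'a
  assumes crystallographic: "crystallographic_root_system \<Phi>"
    and irreducible: "irreducible_roots \<Phi>"
    and simple: "simple_system \<Phi> \<Delta>"
    and highest: "highest_root \<Phi> \<Delta> \<rho>"
begin

lemma finite_roots: "finite \<Phi>" and zero_notin_roots: "0 \<notin> \<Phi>" and span_roots: "span \<Phi> = UNIV"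
  using crystallographic by (auto simp: crystallographic_root_system_def)

lemma inner_root_pos: "\<alpha> \<in> \<Phi> \<Longrightarrow> 0 < \<alpha> \<bullet> \<alpha>"
  using zero_notin_roots by (metis inner_gt_zero_iff)

lemma root_multiples: "\<alpha> \<in> \<Phi> \<Longrightarrow> {c *\<^sub>R \<alpha> | c. c *\<^sub>R \<alpha> \<in> \<Phi>} = {\<alpha>, - \<alpha>}"
  using crystallographic by (auto simp: crystallographic_root_system_def)

lemma minus_root: "\<alpha> \<in> \<Phi> \<Longrightarrow> - \<alpha> \<in> \<Phi>"
proof -
  assume "\<alpha> \<in> \<Phi>"
  then have "- \<alpha> \<in> {c *\<^sub>R \<alpha> | c. c *\<^sub>R \<alpha> \<in> \<Phi>}"
    by (subst root_multiples) auto
  then show "- \<alpha> \<in> \<Phi>"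
    by auto
qed

lemma minus_root_iff [simp]: "- \<alpha> \<in> \<Phi> \<longleftrightarrow> \<alpha> \<in> \<Phi>"
  using minus_root by fastforce

lemma proportional_roots: "\<alpha> \<in> \<Phi> \<Longrightarrow> c *\<^sub>R \<alpha> \<in> \<Phi> \<Longrightarrow> c *\<^sub>R \<alpha> = \<alpha> \<or> c *\<^sub>R \<alpha> = - \<alpha>"
  using root_multiples[of \<alpha>] by blast

lemma fin_reflection_root: "\<alpha> \<in> \<Phi> \<Longrightarrow> \<beta> \<in> \<Phi> \<Longrightarrow> fin_reflection \<alpha> \<beta> \<in> \<Phi>"
  using crystallographic unfolding crystallographic_root_system_def by blast

lemma cartan_integer: "\<alpha> \<in> \<Phi> \<Longrightarrow> \<beta> \<in> \<Phi> \<Longrightarrow> 2 * (\<beta> \<bullet> \<alpha>) / (\<alpha> \<bullet> \<alpha>) \<in> \<int>"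
  using crystallographic by (auto simp: crystallographic_root_system_def)

text \<open>The product of the Cartan integers \<open>p\<close> and \<open>q\<close> is 4 times the
  squared cosine of the angle between two non-proportional roots, hence less than 4. Both integers
  are negative, so one of them is - 1, and the corresponding reflection produces the sum.\<close>

lemma root_add:
  assumes "\<alpha> \<in> \<Phi>" "\<beta> \<in> \<Phi>" "\<alpha> \<bullet> \<beta> < 0" "\<alpha> \<noteq> - \<beta>"
  shows "\<alpha> + \<beta> \<in> \<Phi>"
proof -
  have a: "0 < \<alpha> \<bullet> \<alpha>" and b: "0 < \<beta> \<bullet> \<beta>"
    using assms inner_root_pos by auto
  obtain p q :: int where p: "2 * (\<alpha> \<bullet> \<beta>) / (\<beta> \<bullet> \<beta>) = p" and q: "2 * (\<alpha> \<bullet> \<beta>) / (\<alpha> \<bullet> \<alpha>) = q"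
    using cartan_integer[OF assms(2,1)] cartan_integer[OF assms(1,2)]
    by (metis Ints_cases inner_commute)
  have neg: "p < 0" "q < 0"
    using a b assms(3) p q by (metis divide_neg_pos mult_pos_neg of_int_less_0_iff zero_less_numeral)+
  \<comment> \<open>\<open>w\<close> is a positive multiple of the component of
    \<open>\<beta>\<close> orthogonal to \<open>\<alpha>\<close>, so
    \<open>0 < w \<bullet> w\<close> is the strict Cauchy-Schwarz inequality.\<close>
  define w where "w = (\<alpha> \<bullet> \<alpha>) *\<^sub>R \<beta> - (\<alpha> \<bullet> \<beta>) *\<^sub>R \<alpha>"
  have "w \<noteq> 0"
  proof
    assume "w = 0"
    then have "\<beta> = ((\<alpha> \<bullet> \<beta>) / (\<alpha> \<bullet> \<alpha>)) *\<^sub>R \<alpha>"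
      using a by (simp add: w_def eq_vector_fraction_iff)
    then have "\<beta> = \<alpha> \<or> \<beta> = - \<alpha>"
      using assms(1,2) proportional_roots by metis
    then show False
      using assms(3,4) a by (metis less_asym minus_minus)
  qed
  then have "0 < w \<bullet> w"
    by simp
  also have "w \<bullet> w = (\<alpha> \<bullet> \<alpha>) * ((\<alpha> \<bullet> \<alpha>) * (\<beta> \<bullet> \<beta>) - (\<alpha> \<bullet> \<beta>)\<^sup>2)"
    by (simp add: w_def inner_diff_left inner_diff_right inner_commute power2_eq_square algebra_simps)
  finally have cs: "(\<alpha> \<bullet> \<beta>)\<^sup>2 < (\<alpha> \<bullet> \<alpha>) * (\<beta> \<bullet> \<beta>)"
    using a by (simp add: zero_less_mult_iff)
  have "real_of_int (p * q) = 4 * ((\<alpha> \<bullet> \<beta>)\<^sup>2 / ((\<alpha> \<bullet> \<alpha>) * (\<beta> \<bullet> \<beta>)))"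
    using p[symmetric] q[symmetric] by (simp add: power2_eq_square)
  also have "\<dots> < 4"
  proof -
    have "(\<alpha> \<bullet> \<beta>)\<^sup>2 / ((\<alpha> \<bullet> \<alpha>) * (\<beta> \<bullet> \<beta>)) < 1"
      using cs mult_pos_pos[OF a b] by (simp only: divide_less_eq_1_pos)
    then show ?thesis
      by linarith
  qed
  finally have "p * q < 4"
    by linarith
  moreover have "4 \<le> p * q" if "p \<le> - 2" "q \<le> - 2"
    using mult_mono[of 2 "- p" 2 "- q"] that by simp
  ultimately have "p = - 1 \<or> q = - 1"
    using neg by linarith
  then show ?thesis
  proof
    assume "p = - 1"
    then have "fin_reflection \<beta> \<alpha> = \<alpha> + \<beta>"
      using p by (simp add: fin_reflection_def)
    then show ?thesis
      using fin_reflection_root assms by metis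
  next
    assume "q = - 1"
    then have "fin_reflection \<alpha> \<beta> = \<alpha> + \<beta>"
      using q by (simp add: fin_reflection_def inner_commute)
    then show ?thesis
      using fin_reflection_root assms by metis
  qed
qed

section \<open>Coordinates with respect to the simple roots\<close>

abbreviation coord :: "'a \<Rightarrow> 'a \<Rightarrow> real" where
  "coord v a \<equiv> representation \<Delta> v a"

lemma independent_base: "independent \<Delta>" and base_subset: "\<Delta> \<subseteq> \<Phi>"
  using simple by (auto simp: simple_system_def)

lemma finite_base: "finite \<Delta>"
  using base_subset finite_roots finite_subset by blast

lemma pos_or_neg: "\<alpha> \<in> \<Phi> \<Longrightarrow> \<alpha> \<in> nonneg_combinations \<Delta> \<or> - \<alpha> \<in> nonneg_combinations \<Delta>"
  using simple by (auto simp: simple_system_def)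

lemma nonneg_combinations_span: "nonneg_combinations \<Delta> \<subseteq> span \<Delta>"
  by (auto simp: nonneg_combinations_def intro: span_sum span_scale span_base)

lemma span_base_UNIV: "span \<Delta> = UNIV"
proof -
  have "\<Phi> \<subseteq> span \<Delta>"
    using pos_or_neg nonneg_combinations_span by (metis span_neg minus_minus subset_eq)
  then show ?thesis
    using span_roots span_minimal subspace_span by blast
qed

lemma sum_coord: "(\<Sum>a\<in>\<Delta>. coord v a *\<^sub>R a) = v"
  using real_vector.sum_representation_eq[OF independent_base _ finite_base subset_refl]
  by (simp add: span_base_UNIV)

lemma coord_add: "coord (u + v) a = coord u a + coord v a"
  using real_vector.representation_add[OF independent_base] by (simp add: span_base_UNIV)

lemma coord_scale: "coord (c *\<^sub>R v) a = c * coord v a"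
  using real_vector.representation_scale[OF independent_base] by (simp add: span_base_UNIV)

lemma coord_neg: "coord (- v) a = - coord v a"
  using coord_scale[of "- 1"] by simp

lemma coord_diff: "coord (u - v) a = coord u a - coord v a"
  using coord_add[of u "- v"] by (simp add: coord_neg)

lemma coord_base: "b \<in> \<Delta> \<Longrightarrow> coord b a = (if a = b then 1 else 0)"
  using real_vector.representation_basis[OF independent_base] by auto

lemma coord_sum: "coord (\<Sum>b\<in>X. g b) a = (\<Sum>b\<in>X. coord (g b) a)"
  by (induction X rule: infinite_finite_induct)
    (simp_all add: coord_add real_vector.representation_zero)

lemma coord_eqI: "(\<And>a. a \<in> \<Delta> \<Longrightarrow> coord u a = coord v a) \<Longrightarrow> u = v"
  using sum_coord[of u] sum_coord[of v] by (metis (no_types, lifting) sum.cong)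

lemma nonneg_combinations_iff: "v \<in> nonneg_combinations \<Delta> \<longleftrightarrow> (\<forall>a\<in>\<Delta>. 0 \<le> coord v a)"
proof
  assume "v \<in> nonneg_combinations \<Delta>"
  then obtain c where c: "\<forall>a\<in>\<Delta>. 0 \<le> c a" and v: "v = (\<Sum>b\<in>\<Delta>. c b *\<^sub>R b)"
    by (auto simp: nonneg_combinations_def)
  have "coord v a = c a" if "a \<in> \<Delta>" for a
  proof -
    have "coord v a = (\<Sum>b\<in>\<Delta>. if a = b then c b else 0)"
      unfolding v coord_sum by (rule sum.cong) (auto simp: coord_scale coord_base)
    then show ?thesis
      using that finite_base by simp
  qed
  then show "\<forall>a\<in>\<Delta>. 0 \<le> coord v a"
    using c by simp
next
  assume "\<forall>a\<in>\<Delta>. 0 \<le> coord v a"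
  then show "v \<in> nonneg_combinations \<Delta>"
    unfolding nonneg_combinations_def
    by (intro CollectI exI[of _ "coord v"]) (simp add: sum_coord)
qed

lemma fin_pos_iff: "\<alpha> \<in> fin_pos \<Phi> \<Delta> \<longleftrightarrow> \<alpha> \<in> \<Phi> \<and> (\<forall>a\<in>\<Delta>. 0 \<le> coord \<alpha> a)"
  by (auto simp: fin_pos_def nonneg_combinations_iff)

lemma minus_fin_pos_iff:
  assumes "\<alpha> \<in> \<Phi>"
  shows "- \<alpha> \<in> fin_pos \<Phi> \<Delta> \<longleftrightarrow> \<alpha> \<notin> fin_pos \<Phi> \<Delta>"
proof -
  have "\<alpha> = 0" if "\<forall>a\<in>\<Delta>. 0 \<le> coord \<alpha> a" "\<forall>a\<in>\<Delta>. 0 \<le> coord (- \<alpha>) a"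
    using that by (intro coord_eqI) (auto simp: coord_neg real_vector.representation_zero intro: antisym)
  then show ?thesis
    using assms pos_or_neg[OF assms] zero_notin_roots by (auto simp: fin_pos_iff nonneg_combinations_iff)
qed

lemma highest_root_root: "\<rho> \<in> \<Phi>"
  using highest by (simp add: highest_root_def)

lemma coord_le_highest: "\<alpha> \<in> \<Phi> \<Longrightarrow> a \<in> \<Delta> \<Longrightarrow> coord \<alpha> a \<le> coord \<rho> a"
  using highest by (auto simp: highest_root_def nonneg_combinations_iff coord_diff)

lemma highest_root_fin_pos: "\<rho> \<in> fin_pos \<Phi> \<Delta>"
  using coord_le_highest[OF minus_root[OF highest_root_root]] highest_root_root
  by (fastforce simp: fin_pos_iff coord_neg)

lemma base_fin_pos: "\<Delta> \<subseteq> fin_pos \<Phi> \<Delta>"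
  using base_subset by (auto simp: fin_pos_iff coord_base)

section \<open>The affine root system and the length function\<close>

text \<open>The levels in \<open>hat\<close> start at 0 over a positive finite root and at 1 over a
  negative one, so the sign of the finite part matters only at level 0.\<close>

lemma aff_pos_iff:
  "(\<beta>, c) \<in> aff_pos \<Phi> \<Delta> \<longleftrightarrow> \<beta> \<in> \<Phi> \<and> c \<in> \<int> \<and> (0 < c \<or> c = 0 \<and> \<beta> \<in> fin_pos \<Phi> \<Delta>)"
proof
  assume "(\<beta>, c) \<in> aff_pos \<Phi> \<Delta>"
  then show "\<beta> \<in> \<Phi> \<and> c \<in> \<int> \<and> (0 < c \<or> c = 0 \<and> \<beta> \<in> fin_pos \<Phi> \<Delta>)"
    by (auto simp: aff_pos_def hat_def)
next
  assume *: "\<beta> \<in> \<Phi> \<and> c \<in> \<int> \<and> (0 < c \<or> c = 0 \<and> \<beta> \<in> fin_pos \<Phi> \<Delta>)"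
  then obtain m :: int where "c = m"
    by (auto elim: Ints_cases)
  with * obtain n :: nat where n: "c = real n"
    by (metis le_less of_int_0_le_iff of_int_of_nat_eq zero_le_imp_eq_int)
  show "(\<beta>, c) \<in> aff_pos \<Phi> \<Delta>"
  proof (cases "\<beta> \<in> fin_pos \<Phi> \<Delta>")
    case True
    then show ?thesis
      using * n by (auto simp: aff_pos_def hat_def)
  next
    case False
    then have "- \<beta> \<in> fin_pos \<Phi> \<Delta>" "0 < n"
      using * n minus_fin_pos_iff[of \<beta>] by auto
    then show ?thesis
      using * n unfolding aff_pos_def hat_def
      by (intro UnI2 CollectI exI[of _ \<beta>] exI[of _ "n - 1"]) (auto intro: image_eqI[of _ _ "- \<beta>"])
  qed
qed

lemma minus_aff_pos_iff:
  "(\<beta>, c) \<in> uminus ` aff_pos \<Phi> \<Delta> \<longleftrightarrow> \<beta> \<in> \<Phi> \<and> c \<in> \<int> \<and> (c < 0 \<or> c = 0 \<and> \<beta> \<notin> fin_pos \<Phi> \<Delta>)"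
proof -
  have "(\<beta>, c) \<in> uminus ` aff_pos \<Phi> \<Delta> \<longleftrightarrow> (- \<beta>, - c) \<in> aff_pos \<Phi> \<Delta>"
    by (metis (no_types, lifting) image_iff minus_minus uminus_Pair)
  then show ?thesis
    using minus_fin_pos_iff[of \<beta>] by (auto simp: aff_pos_iff minus_in_Ints_iff)
qed

lemma aff_roots_iff: "(\<beta>, c) \<in> aff_roots \<Phi> \<Delta> \<longleftrightarrow> \<beta> \<in> \<Phi> \<and> c \<in> \<int>"
  unfolding aff_roots_def Un_iff aff_pos_iff minus_aff_pos_iff by auto

lemma minus_aff_pos_iff': "\<gamma> \<in> aff_roots \<Phi> \<Delta> \<Longrightarrow> \<gamma> \<in> uminus ` aff_pos \<Phi> \<Delta> \<longleftrightarrow> \<gamma> \<notin> aff_pos \<Phi> \<Delta>"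
  by (cases \<gamma>) (auto simp only: aff_roots_iff aff_pos_iff minus_aff_pos_iff)

lemma uminus_aff_pos_iff: "\<gamma> \<in> aff_roots \<Phi> \<Delta> \<Longrightarrow> - \<gamma> \<in> aff_pos \<Phi> \<Delta> \<longleftrightarrow> \<gamma> \<notin> aff_pos \<Phi> \<Delta>"
  using minus_aff_pos_iff'[of \<gamma>] image_eqI[of \<gamma> uminus "- \<gamma>" "aff_pos \<Phi> \<Delta>"] by auto

lemma aff_pos_roots: "\<gamma> \<in> aff_pos \<Phi> \<Delta> \<Longrightarrow> \<gamma> \<in> aff_roots \<Phi> \<Delta>"
  by (simp add: aff_roots_def)

lemma aff_simple_pos: "\<sigma> \<in> aff_simple_roots \<Delta> \<rho> \<Longrightarrow> \<sigma> \<in> aff_pos \<Phi> \<Delta>"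
  using base_fin_pos base_subset highest_root_root by (auto simp: aff_simple_roots_def aff_pos_iff)

lemma aform_root_pos: "\<gamma> \<in> aff_roots \<Phi> \<Delta> \<Longrightarrow> 0 < aform \<gamma> \<gamma>"
  using inner_root_pos by (cases \<gamma>) (auto simp: aff_roots_iff aform_def)

lemma aform_linear [simp]:
  "aform (u + v) w = aform u w + aform v w" "aform (c *\<^sub>R u) w = c * aform u w"
  "aform (u - v) w = aform u w - aform v w" "aform (- u) w = - aform u w"
  "aform w (u + v) = aform w u + aform w v" "aform w (c *\<^sub>R u) = c * aform w u"
  "aform w (u - v) = aform w u - aform w v" "aform w (- u) = - aform w u"
  by (simp_all add: aform_def inner_add_left inner_add_right inner_diff_left inner_diff_right)

lemma aform_commute: "aform u v = aform v u"
  by (simp add: aform_def inner_commute)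

lemma linear_reflection: "linear (reflection \<gamma>)"
  by (rule linearI)
    (simp_all add: reflection_def algebra_simps add_divide_distrib)

lemma reflection_involution: "\<gamma> \<in> aff_roots \<Phi> \<Delta> \<Longrightarrow> reflection \<gamma> (reflection \<gamma> v) = v"
  using aform_root_pos[of \<gamma>] by (simp add: reflection_def algebra_simps)

lemma reflection_comp_self: "\<gamma> \<in> aff_roots \<Phi> \<Delta> \<Longrightarrow> reflection \<gamma> \<circ> reflection \<gamma> = id"
  by (auto simp: reflection_involution)

lemma reflection_self: "\<gamma> \<in> aff_roots \<Phi> \<Delta> \<Longrightarrow> reflection \<gamma> \<gamma> = - \<gamma>"
  using aform_root_pos[of \<gamma>] by (simp add: reflection_def scaleR_2)

lemma reflection_uminus: "reflection (- \<gamma>) = reflection \<gamma>"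
  by (rule ext) (simp add: reflection_def)

lemma aform_reflection: "\<gamma> \<in> aff_roots \<Phi> \<Delta> \<Longrightarrow> aform (reflection \<gamma> u) (reflection \<gamma> v) = aform u v"
  using aform_root_pos[of \<gamma>] by (simp add: reflection_def aform_commute field_simps)

text \<open>The finite part is reflected within \<open>\<Phi>\<close>, and the coefficient of
  \<delta> changes by a Cartan integer times an integer.\<close>

lemma reflection_aff_roots:
  assumes "\<gamma> \<in> aff_roots \<Phi> \<Delta>" "v \<in> aff_roots \<Phi> \<Delta>"
  shows "reflection \<gamma> v \<in> aff_roots \<Phi> \<Delta>"
proof -
  define k where "k = 2 * (fst v \<bullet> fst \<gamma>) / (fst \<gamma> \<bullet> fst \<gamma>)"
  have roots: "fst \<gamma> \<in> \<Phi>" "fst v \<in> \<Phi>" "snd \<gamma> \<in> \<int>" "snd v \<in> \<int>"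
    using assms by (cases \<gamma>, cases v, auto simp: aff_roots_iff)+
  have "reflection \<gamma> v = (fin_reflection (fst \<gamma>) (fst v), snd v - k * snd \<gamma>)"
    by (simp add: k_def reflection_def fin_reflection_def aform_def prod_eq_iff)
  moreover have "k \<in> \<int>"
    using cartan_integer roots by (simp add: k_def)
  ultimately show ?thesis
    using fin_reflection_root roots by (simp add: aff_roots_iff)
qed

text \<open>Coordinates of \<open>(v, c)\<close> with respect to the affine simple roots: the coefficient of
  \<open>\<delta> - \<rho>\<close> is \<open>c\<close>, that of \<open>a \<in> \<Delta>\<close> is \<open>coord v a + c * coord \<rho> a\<close>.\<close>

lemma aff_pos_coord:
  assumes "(\<beta>, c) \<in> aff_pos \<Phi> \<Delta>" "a \<in> \<Delta>"
  shows "0 \<le> coord \<beta> a + c * coord \<rho> a" "0 \<le> c"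
proof -
  show "0 \<le> c"
    using assms by (auto simp: aff_pos_iff)
  have "0 \<le> coord \<rho> a"
    using highest_root_fin_pos assms by (auto simp: fin_pos_iff)
  show "0 \<le> coord \<beta> a + c * coord \<rho> a"
  proof (cases "0 < c")
    case True
    then have "1 \<le> c"
      using assms by (auto simp: aff_pos_iff elim!: Ints_cases)
    then have "1 * coord \<rho> a \<le> c * coord \<rho> a"
      using \<open>0 \<le> coord \<rho> a\<close> by (intro mult_right_mono)
    moreover have "- coord \<beta> a \<le> coord \<rho> a"
      using coord_le_highest[of "- \<beta>" a] assms by (auto simp: aff_pos_iff coord_neg)
    ultimately show ?thesis
      by simp
  next
    case False
    then show ?thesis
      using assms by (auto simp: aff_pos_iff fin_pos_iff)
  qed
qed

text \<open>Reflection in \<open>\<sigma>\<close> changes only the coefficient at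
  \<open>\<sigma>\<close>. If the image were negative, all other coefficients of
  \<open>\<gamma>\<close> would vanish, and a positive root proportional to \<open>\<sigma>\<close>
  is \<open>\<sigma>\<close> itself.\<close>

lemma reflection_simple_pos:
  assumes \<sigma>: "\<sigma> \<in> aff_simple_roots \<Delta> \<rho>" and \<gamma>: "\<gamma> \<in> aff_pos \<Phi> \<Delta>" "\<gamma> \<noteq> \<sigma>"
  shows "reflection \<sigma> \<gamma> \<in> aff_pos \<Phi> \<Delta>"
proof (rule ccontr)
  assume neg: "reflection \<sigma> \<gamma> \<notin> aff_pos \<Phi> \<Delta>"
  obtain \<beta> c where \<gamma>_eq: "\<gamma> = (\<beta>, c)"
    by force
  define k where "k = 2 * aform \<gamma> \<sigma> / aform \<sigma> \<sigma>"
  have "reflection \<sigma> \<gamma> \<in> aff_roots \<Phi> \<Delta>"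
    using reflection_aff_roots aff_pos_roots aff_simple_pos \<sigma> \<gamma> by blast
  then have pos': "- reflection \<sigma> \<gamma> \<in> aff_pos \<Phi> \<Delta>"
    using neg uminus_aff_pos_iff by blast
  have \<beta>: "\<beta> \<in> \<Phi>" and c: "c \<in> \<int>"
    using \<gamma>(1) by (auto simp: \<gamma>_eq aff_pos_iff)
  consider a where "a \<in> \<Delta>" "\<sigma> = (a, 0)" | "\<sigma> = (- \<rho>, 1)"
    using \<sigma> by (auto simp: aff_simple_roots_def)
  then show False
  proof cases
    case (1 a)
    have p: "(- \<beta> + k *\<^sub>R a, - c) \<in> aff_pos \<Phi> \<Delta>"
      using pos' unfolding reflection_def k_def[symmetric] by (simp add: \<gamma>_eq 1)
    \<comment> \<open>\<open>c\<close> is the coefficient of \<delta> - \<rho>, which the reflection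
      in \<open>(a, 0)\<close> leaves alone, so both \<open>c\<close> and \<open>- c\<close> are
      nonnegative.\<close>
    have "c = 0"
      using p \<gamma>(1) by (auto simp: \<gamma>_eq aff_pos_iff)
    have "coord \<beta> b = coord (coord \<beta> a *\<^sub>R a) b" if "b \<in> \<Delta>" for b
    proof (cases "b = a")
      case False
      then show ?thesis
        using aff_pos_coord[OF p that] aff_pos_coord[OF \<gamma>(1)[unfolded \<gamma>_eq] that] \<open>c = 0\<close> 1
        by (simp add: coord_add coord_diff coord_neg coord_scale coord_base)
    qed (use 1 in \<open>simp add: coord_scale coord_base\<close>)
    then have eq: "\<beta> = coord \<beta> a *\<^sub>R a"
      by (rule coord_eqI)
    then have "\<beta> = a \<or> \<beta> = - a"
      using proportional_roots[of a] \<beta> base_subset 1 by (metis subsetD)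
    moreover have "\<beta> \<in> fin_pos \<Phi> \<Delta>" "- a \<notin> fin_pos \<Phi> \<Delta>"
      using \<gamma>(1) \<open>c = 0\<close> minus_fin_pos_iff[of a] base_fin_pos base_subset 1 by (auto simp: \<gamma>_eq aff_pos_iff)
    ultimately show False
      using \<gamma> 1 \<open>c = 0\<close> \<gamma>_eq by auto
  next
    case 2
    have p: "(- \<beta> - k *\<^sub>R \<rho>, - c + k) \<in> aff_pos \<Phi> \<Delta>"
      using pos' unfolding reflection_def k_def[symmetric] by (simp add: \<gamma>_eq 2)
    \<comment> \<open>In the coefficient of \<open>p\<close> at \<open>b\<close> the multiples of
      \<open>k\<close> cancel, leaving the negative of the coefficient of \<open>\<gamma>\<close> at
      \<open>b\<close>; both being nonnegative, it is zero.\<close>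
    have "coord \<beta> b = coord ((- c) *\<^sub>R \<rho>) b" if "b \<in> \<Delta>" for b
      using aff_pos_coord[OF p that] aff_pos_coord[OF \<gamma>(1)[unfolded \<gamma>_eq] that]
      by (simp add: coord_diff coord_neg coord_scale algebra_simps)
    then have eq: "\<beta> = (- c) *\<^sub>R \<rho>"
      by (rule coord_eqI)
    then have "(- c) *\<^sub>R \<rho> = \<rho> \<or> (- c) *\<^sub>R \<rho> = - \<rho>"
      using proportional_roots[of \<rho> "- c"] \<beta> highest_root_root by metis
    moreover have "\<rho> \<noteq> 0"
      using highest_root_root zero_notin_roots by metis
    ultimately have "c = - 1 \<or> c = 1"
      by (metis minus_equation_iff scaleR_cancel_right scaleR_minus_left scaleR_one)
    moreover have "0 \<le> c"
      using \<gamma>(1) by (auto simp: \<gamma>_eq aff_pos_iff)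
    ultimately show False
      using eq \<gamma> \<gamma>_eq 2 by simp
  qed
qed

section \<open>Words in the simple reflections\<close>

definition prod_word :: "('a \<times> real \<Rightarrow> 'a \<times> real) list \<Rightarrow> 'a \<times> real \<Rightarrow> 'a \<times> real" where
  "prod_word ss = foldr (\<circ>) ss id"

lemma prod_word_Nil: "prod_word [] = id"
  by (simp add: prod_word_def)

lemma prod_word_Cons: "prod_word (s # ss) = s \<circ> prod_word ss"
  by (simp add: prod_word_def)

lemma prod_word_append: "prod_word (xs @ ys) = prod_word xs \<circ> prod_word ys"
  by (induction xs) (simp_all add: prod_word_Nil prod_word_Cons comp_assoc)

lemma prod_word_single: "prod_word [s] = s"
  by (simp add: prod_word_Nil prod_word_Cons)

text \<open>Length is defined by words in the simple reflections, whereas \<open>aff_weyl\<close> is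
  generated by all reflections. The length theory is developed for \<open>words\<close> and reaches
  the affine Weyl group through \<open>aff_weyl_subset_words\<close>.\<close>

definition words :: "('a \<times> real \<Rightarrow> 'a \<times> real) set" where
  "words = {prod_word ss | ss. set ss \<subseteq> simple_reflections \<Delta> \<rho>}"

lemma id_word: "id \<in> words"
  unfolding words_def by (intro CollectI exI[of _ "[]"]) (simp add: prod_word_Nil)

lemma comp_word: "u \<in> words \<Longrightarrow> w \<in> words \<Longrightarrow> u \<circ> w \<in> words"
  unfolding words_def by (smt (verit) Un_subset_iff prod_word_append mem_Collect_eq set_append)

lemma simple_reflection_word: "\<sigma> \<in> aff_simple_roots \<Delta> \<rho> \<Longrightarrow> reflection \<sigma> \<in> words"
  unfolding words_def
  by (intro CollectI exI[of _ "[reflection \<sigma>]"]) (simp add: simple_reflections_def prod_word_single)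

lemma words_induct [consumes 1, case_names id step]:
  assumes "w \<in> words" and "P id"
    and "\<And>\<sigma> w. \<sigma> \<in> aff_simple_roots \<Delta> \<rho> \<Longrightarrow> w \<in> words \<Longrightarrow> P w \<Longrightarrow> P (reflection \<sigma> \<circ> w)"
  shows "P w"
proof -
  have "P (prod_word ss)" if "set ss \<subseteq> simple_reflections \<Delta> \<rho>" for ss
    using that
  proof (induction ss)
    case (Cons s ss)
    then obtain \<sigma> where \<sigma>: "\<sigma> \<in> aff_simple_roots \<Delta> \<rho>" "s = reflection \<sigma>"
      by (auto simp: simple_reflections_def)
    have "prod_word ss \<in> words"
      unfolding words_def using Cons.prems by (intro CollectI exI[of _ ss]) simp
    then have "P (reflection \<sigma> \<circ> prod_word ss)"
      using assms(3)[OF \<sigma>(1)] Cons by simp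
    then show ?case
      unfolding prod_word_Cons \<sigma>(2) .
  qed (use assms(2) in \<open>simp only: prod_word_Nil\<close>)
  then show ?thesis
    using assms(1) by (auto simp: words_def)
qed

lemma word_inverse: "w \<in> words \<Longrightarrow> \<exists>u\<in>words. u \<circ> w = id \<and> w \<circ> u = id"
proof (induction rule: words_induct)
  case id
  then show ?case
    using id_word by (intro bexI[of _ id]) simp_all
next
  case (step \<sigma> w)
  then obtain u where u: "u \<in> words" "u \<circ> w = id" "w \<circ> u = id"
    by blast
  have "reflection \<sigma> \<circ> reflection \<sigma> = id"
    using step aff_simple_pos aff_pos_roots reflection_comp_self by blast
  then have "(u \<circ> reflection \<sigma>) \<circ> (reflection \<sigma> \<circ> w) = id" "(reflection \<sigma> \<circ> w) \<circ> (u \<circ> reflection \<sigma>) = id"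
    using u by (metis comp_assoc comp_id)+
  then show ?case
    using comp_word[OF u(1) simple_reflection_word] step by blast
qed

lemma word_bij: "w \<in> words \<Longrightarrow> bij w"
  using word_inverse o_bij by blast

lemma inv_word: "w \<in> words \<Longrightarrow> inv w \<in> words"
  using word_inverse by (metis inv_unique_comp)

lemma word_linear: "w \<in> words \<Longrightarrow> linear w"
proof (induction rule: words_induct)
  case id
  show ?case
    by (rule linear_id)
next
  case (step \<sigma> w)
  then show ?case
    using linear_compose linear_reflection by blast
qed

lemma word_aform: "w \<in> words \<Longrightarrow> aform (w u) (w v) = aform u v"
  by (induction rule: words_induct)
    (auto simp: aform_reflection dest!: aff_simple_pos aff_pos_roots)

lemma word_aff_roots: "w \<in> words \<Longrightarrow> \<gamma> \<in> aff_roots \<Phi> \<Delta> \<Longrightarrow> w \<gamma> \<in> aff_roots \<Phi> \<Delta>"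
  by (induction rule: words_induct)
    (auto simp: reflection_aff_roots dest!: aff_simple_pos aff_pos_roots)

text \<open>Conjugating a reflection by a linear isometry of the form gives the reflection in the
  image of the root.\<close>

lemma word_comp_reflection: "w \<in> words \<Longrightarrow> w \<circ> reflection \<gamma> = reflection (w \<gamma>) \<circ> w"
  by (rule ext)
    (simp add: reflection_def linear_diff linear_cmul word_linear word_aform)

section \<open>Inversion sets and length\<close>

lemma inversions_word:
  "w \<in> words \<Longrightarrow> inversions \<Phi> \<Delta> w = {\<gamma> \<in> aff_pos \<Phi> \<Delta>. inv w \<gamma> \<notin> aff_pos \<Phi> \<Delta>}"
  unfolding inversions_def
  using minus_aff_pos_iff'[OF word_aff_roots[OF inv_word aff_pos_roots]] by blast

text \<open>Reflection in \<open>\<sigma>\<close> permutes the positive roots other than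
  \<open>\<sigma>\<close>, so composing with it alters the sign of the preimage of a positive root
  only at \<open>w \<sigma>\<close>.\<close>

lemma inversions_comp_simple:
  assumes w: "w \<in> words" and \<sigma>: "\<sigma> \<in> aff_simple_roots \<Delta> \<rho>" and pos: "w \<sigma> \<in> aff_pos \<Phi> \<Delta>"
  shows "inversions \<Phi> \<Delta> (w \<circ> reflection \<sigma>) = insert (w \<sigma>) (inversions \<Phi> \<Delta> w)"
    and "w \<sigma> \<notin> inversions \<Phi> \<Delta> w"
proof -
  have \<sigma>_pos: "\<sigma> \<in> aff_pos \<Phi> \<Delta>" and \<sigma>_root: "\<sigma> \<in> aff_roots \<Phi> \<Delta>"
    using \<sigma> aff_simple_pos aff_pos_roots by auto
  have inv_w: "inv w (w v) = v" "w (inv w v) = v" for v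
    using word_bij[OF w] by (simp_all add: bij_is_inj bij_is_surj surj_f_inv_f)
  have ws: "w \<circ> reflection \<sigma> \<in> words"
    using comp_word w simple_reflection_word \<sigma> by blast
  have "inv (w \<circ> reflection \<sigma>) = reflection \<sigma> \<circ> inv w"
    by (rule inv_unique_comp) (auto simp: inv_w reflection_involution \<sigma>_root)
  then have N: "inversions \<Phi> \<Delta> (w \<circ> reflection \<sigma>) =
      {\<gamma> \<in> aff_pos \<Phi> \<Delta>. reflection \<sigma> (inv w \<gamma>) \<notin> aff_pos \<Phi> \<Delta>}"
    using inversions_word[OF ws] by simp
  show "w \<sigma> \<notin> inversions \<Phi> \<Delta> w"
    using inversions_word[OF w] \<sigma>_pos by (simp add: inv_w)
  have "reflection \<sigma> (inv w \<gamma>) \<notin> aff_pos \<Phi> \<Delta> \<longleftrightarrow> \<gamma> = w \<sigma> \<or> inv w \<gamma> \<notin> aff_pos \<Phi> \<Delta>"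
    if \<gamma>: "\<gamma> \<in> aff_pos \<Phi> \<Delta>" for \<gamma>
  proof (cases "\<gamma> = w \<sigma>")
    case True
    then show ?thesis
      using uminus_aff_pos_iff[OF \<sigma>_root] \<sigma>_pos by (simp add: inv_w reflection_self \<sigma>_root)
  next
    case False
    define \<beta> where "\<beta> = inv w \<gamma>"
    have \<beta>_root: "\<beta> \<in> aff_roots \<Phi> \<Delta>"
      using word_aff_roots inv_word w \<gamma> aff_pos_roots by (auto simp: \<beta>_def)
    have "\<beta> \<noteq> \<sigma>"
      using False inv_w(2)[of \<gamma>] by (metis \<beta>_def)
    \<comment> \<open>Whichever of \<open>\<beta>\<close> and \<open>- \<beta>\<close> is positive
      has to differ from \<open>\<sigma>\<close> for \<open>reflection_simple_pos\<close> to apply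
      to it.\<close>
    moreover have "- \<beta> \<noteq> \<sigma>"
    proof
      assume "- \<beta> = \<sigma>"
      then have "w \<sigma> = - \<gamma>"
        using inv_w linear_neg[OF word_linear[OF w]] by (metis \<beta>_def)
      then show False
        using pos \<gamma> uminus_aff_pos_iff aff_pos_roots by metis
    qed
    ultimately have "reflection \<sigma> \<beta> \<in> aff_pos \<Phi> \<Delta> \<longleftrightarrow> \<beta> \<in> aff_pos \<Phi> \<Delta>"
      using reflection_simple_pos[OF \<sigma>] uminus_aff_pos_iff \<beta>_root reflection_aff_roots[OF \<sigma>_root \<beta>_root]
        linear_neg[OF linear_reflection] by metis
    then show ?thesis
      using False by (simp add: \<beta>_def)
  qed
  then show "inversions \<Phi> \<Delta> (w \<circ> reflection \<sigma>) = insert (w \<sigma>) (inversions \<Phi> \<Delta> w)"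
    unfolding N inversions_word[OF w] using pos by blast
qed

text \<open>Apply the letters to \<open>\<sigma>\<close> from the right. At the first letter
  \<open>s\<close> that makes the root negative, the positive root reached is the simple root of
  \<open>s\<close>, so multiplying by the reflection in \<open>\<sigma>\<close> on the right amounts
  to deleting \<open>s\<close>.\<close>

lemma exchange:
  assumes "set ss \<subseteq> simple_reflections \<Delta> \<rho>" "\<sigma> \<in> aff_simple_roots \<Delta> \<rho>"
    and "prod_word ss \<sigma> \<notin> aff_pos \<Phi> \<Delta>"
  shows "\<exists>ts. set ts \<subseteq> simple_reflections \<Delta> \<rho> \<and> length ts < length ss \<and>
    prod_word ts = prod_word ss \<circ> reflection \<sigma>"
  using assms
proof (induction ss)
  case Nil
  then show ?case
    using aff_simple_pos by (simp add: prod_word_Nil)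
next
  case (Cons s ss)
  define u where "u = prod_word ss"
  have u: "u \<in> words"
    using Cons.prems by (auto simp: u_def words_def)
  obtain \<tau> where \<tau>: "\<tau> \<in> aff_simple_roots \<Delta> \<rho>" "s = reflection \<tau>"
    using Cons.prems by (auto simp: simple_reflections_def)
  show ?case
  proof (cases "u \<sigma> \<in> aff_pos \<Phi> \<Delta>")
    case True
    moreover have "s (u \<sigma>) \<notin> aff_pos \<Phi> \<Delta>"
      using Cons.prems(3) by (simp add: u_def prod_word_Cons)
    ultimately have "u \<sigma> = \<tau>"
      using reflection_simple_pos \<tau> by blast
    then have "s \<circ> u \<circ> reflection \<sigma> = s \<circ> (s \<circ> u)"
      using word_comp_reflection[OF u] \<tau> by (simp add: comp_assoc)
    also have "\<dots> = u"
      using reflection_comp_self[OF aff_pos_roots[OF aff_simple_pos]] \<tau>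
      by (simp add: comp_assoc[symmetric])
    finally have "prod_word ss = prod_word (s # ss) \<circ> reflection \<sigma>"
      unfolding u_def prod_word_Cons by (rule sym)
    then show ?thesis
      using Cons.prems(1) by (intro exI[of _ ss]) simp
  next
    case False
    have "set ss \<subseteq> simple_reflections \<Delta> \<rho>"
      using Cons.prems(1) by simp
    from Cons.IH[OF this Cons.prems(2) False[unfolded u_def]]
    obtain ts where ts: "set ts \<subseteq> simple_reflections \<Delta> \<rho>" "length ts < length ss"
        "prod_word ts = prod_word ss \<circ> reflection \<sigma>"
      by blast
    have "prod_word (s # ts) = prod_word (s # ss) \<circ> reflection \<sigma>"
      unfolding prod_word_Cons ts(3) by (rule comp_assoc[symmetric])
    then show ?thesis
      using Cons.prems(1) ts by (intro exI[of _ "s # ts"]) simp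
  qed
qed

lemma aff_length_prod_word: "aff_length \<Delta> \<rho> w =
    (LEAST n. \<exists>ss. length ss = n \<and> set ss \<subseteq> simple_reflections \<Delta> \<rho> \<and> prod_word ss = w)"
  unfolding aff_length_def prod_word_def by (rule refl)

lemma aff_length_le:
  "set ss \<subseteq> simple_reflections \<Delta> \<rho> \<Longrightarrow> aff_length \<Delta> \<rho> (prod_word ss) \<le> length ss"
  unfolding aff_length_prod_word by (rule Least_le) blast

lemma reduced_word:
  assumes "w \<in> words"
  obtains ss where "length ss = aff_length \<Delta> \<rho> w" "set ss \<subseteq> simple_reflections \<Delta> \<rho>"
    "prod_word ss = w"
proof -
  have "\<exists>ss. length ss = aff_length \<Delta> \<rho> w \<and> set ss \<subseteq> simple_reflections \<Delta> \<rho> \<and> prod_word ss = w"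
    unfolding aff_length_prod_word by (rule LeastI_ex) (use assms in \<open>auto simp: words_def\<close>)
  then show ?thesis
    using that by blast
qed

text \<open>Induction along a reduced word: removing the last letter lowers the length by exactly
  one. That letter adds one inversion, because \<open>u \<sigma>\<close> is positive; otherwise
  \<open>exchange\<close> would give a word for \<open>w\<close> that is too short.\<close>

lemma card_inversions:
  "w \<in> words \<Longrightarrow> finite (inversions \<Phi> \<Delta> w) \<and> card (inversions \<Phi> \<Delta> w) = aff_length \<Delta> \<rho> w"
proof (induction "aff_length \<Delta> \<rho> w" arbitrary: w)
  case 0
  then have "w = id"
    using reduced_word[of w] by (metis length_0_conv prod_word_Nil)
  then show ?case
    using 0 by (simp add: inversions_word id_word)
next
  case (Suc n)
  obtain ss where ss: "length ss = Suc n" "set ss \<subseteq> simple_reflections \<Delta> \<rho>" "prod_word ss = w"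
    using reduced_word Suc.prems Suc.hyps by metis
  then obtain ts s where ss_eq: "ss = ts @ [s]"
    by (metis length_Suc_conv_rev)
  obtain \<sigma> where \<sigma>: "\<sigma> \<in> aff_simple_roots \<Delta> \<rho>" "s = reflection \<sigma>"
    using ss ss_eq by (auto simp: simple_reflections_def)
  define u where "u = prod_word ts"
  have ts: "set ts \<subseteq> simple_reflections \<Delta> \<rho>" "length ts = n"
    using ss ss_eq by auto
  then have u: "u \<in> words"
    by (auto simp: u_def words_def)
  have w: "w = u \<circ> reflection \<sigma>"
    using ss ss_eq \<sigma> prod_word_append[of ts "[s]"] by (simp add: u_def prod_word_single)
  have "aff_length \<Delta> \<rho> u = n"
  proof (rule antisym)
    show "aff_length \<Delta> \<rho> u \<le> n"
      using aff_length_le ts u_def by metis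
    obtain us where us: "length us = aff_length \<Delta> \<rho> u" "set us \<subseteq> simple_reflections \<Delta> \<rho>"
        "prod_word us = u"
      using reduced_word u by metis
    then have "aff_length \<Delta> \<rho> w \<le> length (us @ [s])"
      using aff_length_le[of "us @ [s]"] ss ss_eq w prod_word_append[of us "[s]"] \<sigma>(2)
      by (simp add: prod_word_single)
    then show "n \<le> aff_length \<Delta> \<rho> u"
      using us Suc.hyps by simp
  qed
  then have IH: "finite (inversions \<Phi> \<Delta> u)" "card (inversions \<Phi> \<Delta> u) = n"
    using Suc.hyps(1) u by auto
  have "u \<sigma> \<in> aff_pos \<Phi> \<Delta>"
  proof (rule ccontr)
    assume "u \<sigma> \<notin> aff_pos \<Phi> \<Delta>"
    then obtain us where "set us \<subseteq> simple_reflections \<Delta> \<rho>" "length us < n" "prod_word us = w"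
      using exchange[OF ts(1) \<sigma>(1)] ts(2) w u_def by metis
    then show False
      using aff_length_le Suc.hyps(2) by fastforce
  qed
  from inversions_comp_simple[OF u \<sigma>(1) this] show ?case
    using IH w Suc.hyps(2) by simp
qed

section \<open>Reflections in arbitrary roots as words\<close>

lemma simple_root_acute:
  assumes "\<gamma> \<in> aff_pos \<Phi> \<Delta>"
  shows "\<exists>\<sigma>\<in>aff_simple_roots \<Delta> \<rho>. 0 < aform \<gamma> \<sigma>"
proof (rule ccontr)
  assume "\<not> ?thesis"
  then have le: "aform \<gamma> \<sigma> \<le> 0" if "\<sigma> \<in> aff_simple_roots \<Delta> \<rho>" for \<sigma>
    using that by (meson not_less)
  obtain \<beta> c where \<gamma>: "\<gamma> = (\<beta>, c)"
    by force
  have pos: "0 \<le> c" "\<And>a. a \<in> \<Delta> \<Longrightarrow> 0 \<le> coord (\<beta> + c *\<^sub>R \<rho>) a"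
    using assms aff_pos_coord by (auto simp: \<gamma> coord_add coord_scale aff_pos_iff)
  \<comment> \<open>Expand \<open>\<gamma>\<close> in the affine simple roots: the coefficients are
    those of \<open>\<beta> + c *\<^sub>R \<rho>\<close> on \<open>\<Delta>\<close> and
    \<open>c\<close> at \<delta> - \<rho>. They are nonnegative, so if all products with simple
    roots were nonpositive, \<open>\<beta> \<bullet> \<beta>\<close> would be too.\<close>
  have "\<beta> \<bullet> (\<beta> + c *\<^sub>R \<rho>) = (\<Sum>a\<in>\<Delta>. coord (\<beta> + c *\<^sub>R \<rho>) a * (\<beta> \<bullet> a))"
    using sum_coord[of "\<beta> + c *\<^sub>R \<rho>"] by (metis (no_types, lifting) inner_scaleR_right inner_sum_right sum.cong)
  also have "\<dots> \<le> 0"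
  proof (intro sum_nonpos mult_nonneg_nonpos)
    fix a assume "a \<in> \<Delta>"
    then show "\<beta> \<bullet> a \<le> 0" "0 \<le> coord (\<beta> + c *\<^sub>R \<rho>) a"
      using le[of "(a, 0)"] pos by (auto simp: \<gamma> aff_simple_roots_def aform_def)
  qed
  finally have "\<beta> \<bullet> \<beta> \<le> c * (\<beta> \<bullet> (- \<rho>))"
    by (simp add: inner_add_right)
  also have "\<dots> \<le> 0"
    using pos le[of "(- \<rho>, 1)"] by (intro mult_nonneg_nonpos) (auto simp: \<gamma> aff_simple_roots_def aform_def)
  finally show False
    using inner_root_pos[of \<beta>] assms by (simp add: \<gamma> aff_pos_iff del: inner_gt_zero_iff)
qed

text \<open>The sum of the coefficients with respect to the affine simple roots, expressed through
  the coordinates on \<open>\<Delta>\<close>.\<close>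

definition height :: "'a \<times> real \<Rightarrow> real" where
  "height v = (\<Sum>a\<in>\<Delta>. coord (fst v) a) + snd v * (1 + (\<Sum>a\<in>\<Delta>. coord \<rho> a))"

lemma height_highest_nonneg: "0 \<le> (\<Sum>a\<in>\<Delta>. coord \<rho> a)"
  using highest_root_fin_pos by (intro sum_nonneg) (auto simp: fin_pos_iff)

lemma height_simple: "\<sigma> \<in> aff_simple_roots \<Delta> \<rho> \<Longrightarrow> height \<sigma> = 1"
  using finite_base
  by (auto simp: aff_simple_roots_def height_def coord_base coord_neg sum_negf)

lemma height_diff_scale: "height (u - k *\<^sub>R v) = height u - k * height v"
  by (simp add: height_def coord_diff coord_scale sum_subtractf sum_distrib_left algebra_simps)

text \<open>The height grows at least as fast as the level, while the finite part contributes a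
  bounded amount; so only finitely many levels occur. This makes induction on the number of lower
  roots possible.\<close>

lemma finite_height_less: "finite {\<gamma> \<in> aff_pos \<Phi> \<Delta>. height \<gamma> < h}"
proof -
  define K where "K = (\<Sum>\<beta>\<in>\<Phi>. \<bar>\<Sum>a\<in>\<Delta>. coord \<beta> a\<bar>)"
  have "{\<gamma> \<in> aff_pos \<Phi> \<Delta>. height \<gamma> < h} \<subseteq> \<Phi> \<times> {c \<in> \<int>. \<bar>c\<bar> \<le> \<bar>h\<bar> + K}"
  proof
    fix \<gamma> assume *: "\<gamma> \<in> {\<gamma> \<in> aff_pos \<Phi> \<Delta>. height \<gamma> < h}"
    obtain \<beta> c where \<gamma>: "\<gamma> = (\<beta>, c)"
      by force
    have \<beta>: "\<beta> \<in> \<Phi>" and c: "c \<in> \<int>" "0 \<le> c"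
      using * by (auto simp: \<gamma> aff_pos_iff)
    have "\<bar>\<Sum>a\<in>\<Delta>. coord \<beta> a\<bar> \<le> K"
      unfolding K_def by (rule member_le_sum[OF \<beta>]) (auto simp: finite_roots)
    moreover have "c \<le> c * (1 + (\<Sum>a\<in>\<Delta>. coord \<rho> a))"
      using c height_highest_nonneg by (simp add: algebra_simps)
    ultimately show "\<gamma> \<in> \<Phi> \<times> {c \<in> \<int>. \<bar>c\<bar> \<le> \<bar>h\<bar> + K}"
      using * \<beta> c by (auto simp: \<gamma> height_def)
  qed
  moreover have "finite {c \<in> \<int>. \<bar>c\<bar> \<le> \<bar>h\<bar> + K}"
    by (rule finite_abs_int_segment)
  ultimately show ?thesis
    using finite_roots finite_subset by blast
qed

text \<open>A simple reflection in a root at an acute angle to \<open>\<gamma>\<close> yields a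
  positive root \<open>\<gamma>'\<close> of smaller height, unless \<open>\<gamma>\<close> is that
  simple root. The reflection in \<open>\<gamma>\<close> is then a conjugate of the one in
  \<open>\<gamma>'\<close>.\<close>

lemma reflection_pos_word: "\<gamma> \<in> aff_pos \<Phi> \<Delta> \<Longrightarrow> reflection \<gamma> \<in> words"
proof (induction "card {\<beta> \<in> aff_pos \<Phi> \<Delta>. height \<beta> < height \<gamma>}" arbitrary: \<gamma> rule: less_induct)
  case less
  obtain \<sigma> where \<sigma>: "\<sigma> \<in> aff_simple_roots \<Delta> \<rho>" "0 < aform \<gamma> \<sigma>"
    using simple_root_acute less.prems by blast
  show ?case
  proof (cases "\<gamma> = \<sigma>")
    case True
    then show ?thesis
      using \<sigma> simple_reflection_word by blast
  next
    case False
    have \<sigma>_root: "\<sigma> \<in> aff_roots \<Phi> \<Delta>"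
      using \<sigma> aff_simple_pos aff_pos_roots by blast
    define \<gamma>' where "\<gamma>' = reflection \<sigma> \<gamma>"
    have \<gamma>': "\<gamma>' \<in> aff_pos \<Phi> \<Delta>"
      using reflection_simple_pos \<sigma> False less.prems by (simp add: \<gamma>'_def)
    have h: "height \<gamma>' < height \<gamma>"
      using \<sigma> aform_root_pos[OF \<sigma>_root] by (simp add: \<gamma>'_def reflection_def height_diff_scale height_simple)
    have "{\<beta> \<in> aff_pos \<Phi> \<Delta>. height \<beta> < height \<gamma>'} \<subset> {\<beta> \<in> aff_pos \<Phi> \<Delta>. height \<beta> < height \<gamma>}"
      using h \<gamma>' by force
    then have "reflection \<gamma>' \<in> words"
      using less.hyps[OF psubset_card_mono[OF finite_height_less] \<gamma>'] by blast
    moreover have "reflection \<gamma> = reflection \<sigma> \<circ> reflection \<gamma>' \<circ> reflection \<sigma>"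
      using word_comp_reflection[OF simple_reflection_word[OF \<sigma>(1)], of \<gamma>'] reflection_comp_self[OF \<sigma>_root]
      by (simp add: \<gamma>'_def reflection_involution \<sigma>_root comp_assoc)
    ultimately show ?thesis
      using comp_word simple_reflection_word \<sigma> by metis
  qed
qed

lemma aff_weyl_subset_words: "aff_weyl \<Phi> \<Delta> \<subseteq> words"
proof
  have refl: "reflection \<gamma> \<in> words" if "\<gamma> \<in> aff_roots \<Phi> \<Delta>" for \<gamma>
    using that reflection_pos_word unfolding aff_roots_def by (metis UnE imageE reflection_uminus)
  fix w assume "w \<in> aff_weyl \<Phi> \<Delta>"
  then have "w \<in> generated_group (aff_reflections \<Phi> \<Delta>)"
    by (simp add: aff_weyl_def)
  then show "w \<in> words"
  proof induction
    case (gen s)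
    then show ?case
      using refl by (auto simp: aff_reflections_def)
  qed (rule id_word inv_word comp_word; assumption)+
qed

section \<open>Translations\<close>

text \<open>The linear form of the translation by \<open>x\<close>: a shear of the space along
  \<delta> that keeps the finite part fixed.\<close>

definition translation :: "'a \<Rightarrow> 'a \<times> real \<Rightarrow> 'a \<times> real" where
  "translation x v = (fst v, snd v + fst v \<bullet> x)"

definition translation_lattice :: "'a set" where
  "translation_lattice = {x. translation x \<in> aff_weyl \<Phi> \<Delta>}"

lemma translation_comp: "translation x \<circ> translation y = translation (x + y)"
  by (rule ext) (simp add: translation_def inner_add_right)

lemma translation_zero: "translation 0 = id"
  by (rule ext) (simp add: translation_def)

lemma inv_translation: "inv (translation x) = translation (- x)"
  by (rule inv_unique_comp) (simp_all only: translation_comp translation_zero right_minus left_minus)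

lemma zero_lattice: "0 \<in> translation_lattice"
  unfolding translation_lattice_def mem_Collect_eq translation_zero aff_weyl_def
  by (rule generated_group.one)

lemma add_lattice:
  "x \<in> translation_lattice \<Longrightarrow> y \<in> translation_lattice \<Longrightarrow> x + y \<in> translation_lattice"
  unfolding translation_lattice_def mem_Collect_eq translation_comp[symmetric] aff_weyl_def
  by (rule generated_group.mult)

lemma minus_lattice: "x \<in> translation_lattice \<Longrightarrow> - x \<in> translation_lattice"
  unfolding translation_lattice_def mem_Collect_eq inv_translation[symmetric] aff_weyl_def
  by (rule generated_group.inverse)

lemma scale_lattice:
  assumes "x \<in> translation_lattice"
  shows "of_int n *\<^sub>R x \<in> translation_lattice"
proof (induction n rule: int_induct[where k = 0])
  case base
  then show ?case
    using zero_lattice by simp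
next
  case (step1 n)
  then show ?case
    using add_lattice[OF _ assms] by (simp add: scaleR_add_left)
next
  case (step2 n)
  then show ?case
    using add_lattice[OF _ minus_lattice[OF assms]] by (simp add: scaleR_diff_left)
qed

lemma sum_lattice: "(\<And>i. i \<in> I \<Longrightarrow> g i \<in> translation_lattice) \<Longrightarrow> (\<Sum>i\<in>I. g i) \<in> translation_lattice"
  by (induction I rule: infinite_finite_induct) (auto simp: zero_lattice add_lattice)

text \<open>The reflections in the parallel affine roots \<alpha> and \<alpha> - \<delta> compose to
  the translation by the coroot of \<alpha>.\<close>

lemma coroot_lattice:
  assumes "\<alpha> \<in> \<Phi>"
  shows "(2 / (\<alpha> \<bullet> \<alpha>)) *\<^sub>R \<alpha> \<in> translation_lattice"
proof -
  have refl: "reflection (\<alpha>, c) \<in> generated_group (aff_reflections \<Phi> \<Delta>)" if "c \<in> \<int>" for c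
    using assms that by (intro generated_group.gen) (auto simp: aff_reflections_def aff_roots_iff)
  have "translation ((2 / (\<alpha> \<bullet> \<alpha>)) *\<^sub>R \<alpha>) = reflection (\<alpha>, 0) \<circ> reflection (\<alpha>, - 1)"
    using inner_root_pos[OF assms]
    by (intro ext)
      (simp add: translation_def reflection_def aform_def prod_eq_iff inner_diff_left field_simps)
  then show ?thesis
    using generated_group.mult[OF refl[of 0] refl[of "- 1"]]
    by (simp only: translation_lattice_def mem_Collect_eq aff_weyl_def) simp
qed

text \<open>Rounding down the coordinates of \<open>v\<close> with respect to the simple coroots
  gives a lattice point; the remainder lies in a fixed bounded parallelepiped.\<close>

lemma lattice_dense: "\<exists>D. \<forall>v. \<exists>x\<in>translation_lattice. norm (v - x) \<le> D"
proof (intro exI allI)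
  define co where "co a = (2 / (a \<bullet> a)) *\<^sub>R a" for a :: 'a
  fix v
  \<comment> \<open>The coordinates with respect to the coroots \<open>co a\<close>; the factor
    undoes their normalisation.\<close>
  define c where "c a = coord v a * (a \<bullet> a) / 2" for a
  have "v = (\<Sum>a\<in>\<Delta>. c a *\<^sub>R co a)"
  proof -
    have "(\<Sum>a\<in>\<Delta>. c a *\<^sub>R co a) = (\<Sum>a\<in>\<Delta>. coord v a *\<^sub>R a)"
    proof (rule sum.cong)
      fix a assume "a \<in> \<Delta>"
      then have "a \<bullet> a \<noteq> 0"
        using inner_root_pos base_subset by fastforce
      then show "c a *\<^sub>R co a = coord v a *\<^sub>R a"
        by (simp add: c_def co_def)
    qed simp
    then show ?thesis
      using sum_coord by simp
  qed
  then have "v - (\<Sum>a\<in>\<Delta>. of_int \<lfloor>c a\<rfloor> *\<^sub>R co a) = (\<Sum>a\<in>\<Delta>. frac (c a) *\<^sub>R co a)"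
    by (simp add: sum_subtractf[symmetric] scaleR_diff_left[symmetric] frac_def)
  moreover have "norm (\<Sum>a\<in>\<Delta>. frac (c a) *\<^sub>R co a) \<le> (\<Sum>a\<in>\<Delta>. norm (co a))"
    by (intro sum_norm_le) (simp add: mult_left_le_one_le frac_lt_1 less_imp_le)
  moreover have "(\<Sum>a\<in>\<Delta>. of_int \<lfloor>c a\<rfloor> *\<^sub>R co a) \<in> translation_lattice"
    using scale_lattice coroot_lattice base_subset by (intro sum_lattice) (auto simp: co_def simp del: scaleR_scaleR)
  ultimately show "\<exists>x\<in>translation_lattice. norm (v - x) \<le> (\<Sum>a\<in>\<Delta>. norm (co a))"
    by (intro bexI[of _ "\<Sum>a\<in>\<Delta>. of_int \<lfloor>c a\<rfloor> *\<^sub>R co a"]) simp_all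
qed

lemma translation_word: "x \<in> translation_lattice \<Longrightarrow> translation x \<in> words"
  using aff_weyl_subset_words by (auto simp: translation_lattice_def)

text \<open>The translation maps \<open>(\<beta>, 0)\<close> to a root whose level is
  \<open>\<beta> \<bullet> x\<close>, and roots have integer level.\<close>

lemma inner_lattice_integer:
  assumes "x \<in> translation_lattice" "\<beta> \<in> \<Phi>"
  shows "\<beta> \<bullet> x \<in> \<int>"
  using word_aff_roots[OF translation_word[OF assms(1)], of "(\<beta>, 0)"] assms(2)
  by (simp add: aff_roots_iff translation_def)

lemma inner_roots_eqI:
  assumes "\<And>\<beta>. \<beta> \<in> \<Phi> \<Longrightarrow> \<beta> \<bullet> x = \<beta> \<bullet> y"
  shows "x = y"
proof -
  have "x - y \<in> span \<Phi>"
    by (simp add: span_roots)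
  moreover have "orthogonal (x - y) \<beta>" if "\<beta> \<in> \<Phi>" for \<beta>
    using assms[OF that] by (simp add: orthogonal_def inner_commute[of _ \<beta>] inner_diff_right)
  ultimately have "orthogonal (x - y) (x - y)"
    using orthogonal_to_span by blast
  then show ?thesis
    by (simp add: orthogonal_def)
qed

text \<open>Numbers the positive affine roots over \<open>\<beta>\<close> from 0 on, so that the two
  signs of \<open>\<beta>\<close> need not be distinguished when counting.\<close>

definition root_at :: "'a \<Rightarrow> nat \<Rightarrow> 'a \<times> real" where
  "root_at \<beta> i = (\<beta>, real i + (if \<beta> \<in> fin_pos \<Phi> \<Delta> then 0 else 1))"

lemma root_at_pos: "\<beta> \<in> \<Phi> \<Longrightarrow> root_at \<beta> i \<in> aff_pos \<Phi> \<Delta>"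
  by (auto simp: root_at_def aff_pos_iff)

lemma root_at_eq_iff [simp]: "root_at \<alpha> i = root_at \<beta> j \<longleftrightarrow> \<alpha> = \<beta> \<and> i = j"
  by (auto simp: root_at_def)

lemma aff_pos_cases:
  assumes "(\<beta>, c) \<in> aff_pos \<Phi> \<Delta>"
  obtains i where "\<beta> \<in> \<Phi>" "(\<beta>, c) = root_at \<beta> i"
proof -
  define s :: int where "s = (if \<beta> \<in> fin_pos \<Phi> \<Delta> then 0 else 1)"
  obtain m :: int where m: "c = m"
    using assms by (auto simp: aff_pos_iff elim: Ints_cases)
  then have "s \<le> m"
    using assms by (auto simp: aff_pos_iff s_def)
  then have "(\<beta>, c) = root_at \<beta> (nat (m - s))"
    by (auto simp: root_at_def m s_def)
  moreover have "\<beta> \<in> \<Phi>"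
    using assms by (simp add: aff_pos_iff)
  ultimately show ?thesis
    using that by blast
qed

text \<open>The inverse translation lowers the level over \<open>\<beta>\<close> by
  \<open>\<beta> \<bullet> x\<close>. The offset in \<open>root_at\<close> is also the threshold of
  positivity, so it cancels, and exactly the first \<open>\<beta> \<bullet> x\<close> roots become
  negative; \<open>nat\<close> yields none if the product is negative.\<close>

lemma inversions_translation:
  assumes x: "x \<in> translation_lattice"
  shows "inversions \<Phi> \<Delta> (translation x) =
    (\<lambda>(\<beta>, i). root_at \<beta> i) ` (SIGMA \<beta>:\<Phi>. {..<nat \<lfloor>\<beta> \<bullet> x\<rfloor>})"
proof -
  have "root_at \<beta> i \<in> inversions \<Phi> \<Delta> (translation x) \<longleftrightarrow> i < nat \<lfloor>\<beta> \<bullet> x\<rfloor>" if \<beta>: "\<beta> \<in> \<Phi>" for \<beta> i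
  proof -
    obtain m :: int where "\<beta> \<bullet> x = m"
      using inner_lattice_integer[OF x \<beta>] by (auto elim: Ints_cases)
    then show ?thesis
      using \<beta> unfolding inversions_word[OF translation_word[OF x]] inv_translation
      by (auto simp: root_at_pos translation_def root_at_def aff_pos_iff)
  qed
  note iff = this
  show ?thesis
  proof (intro subset_antisym subsetI)
    fix \<gamma> assume \<gamma>: "\<gamma> \<in> inversions \<Phi> \<Delta> (translation x)"
    then have "(fst \<gamma>, snd \<gamma>) \<in> aff_pos \<Phi> \<Delta>"
      by (simp add: inversions_def)
    then obtain i where "fst \<gamma> \<in> \<Phi>" "\<gamma> = root_at (fst \<gamma>) i"
      by (rule aff_pos_cases) simp
    then show "\<gamma> \<in> (\<lambda>(\<beta>, i). root_at \<beta> i) ` (SIGMA \<beta>:\<Phi>. {..<nat \<lfloor>\<beta> \<bullet> x\<rfloor>})"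
      using \<gamma> iff by (intro image_eqI[of _ _ "(fst \<gamma>, i)"]) (simp, metis SigmaI lessThan_iff)
  qed (auto simp: iff)
qed

lemma sum_inversions_translation:
  assumes "x \<in> translation_lattice"
  shows "(\<Sum>\<gamma>\<in>inversions \<Phi> \<Delta> (translation x). g \<gamma>) = (\<Sum>\<beta>\<in>\<Phi>. \<Sum>i<nat \<lfloor>\<beta> \<bullet> x\<rfloor>. g (root_at \<beta> i))"
proof -
  have "inj_on (\<lambda>(\<beta>, i). root_at \<beta> i) (SIGMA \<beta>:\<Phi>. {..<nat \<lfloor>\<beta> \<bullet> x\<rfloor>})"
    by (auto simp: inj_on_def)
  then show ?thesis
    unfolding inversions_translation[OF assms]
    by (simp add: sum.reindex sum.Sigma finite_roots case_prod_unfold)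
qed

lemma sum_roots_uminus: "(\<Sum>\<beta>\<in>\<Phi>. g (- \<beta>)) = (\<Sum>\<beta>\<in>\<Phi>. g \<beta>)"
  by (rule sum.reindex_bij_witness[of _ uminus uminus]) auto

text \<open>The length is the sum of the positive parts of \<open>\<beta> \<bullet> x\<close>, which
  is invariant under \<open>\<beta>\<close> going to \<open>- \<beta>\<close>.\<close>

lemma aff_length_translation_minus:
  assumes "x \<in> translation_lattice"
  shows "aff_length \<Delta> \<rho> (translation (- x)) = aff_length \<Delta> \<rho> (translation x)"
proof -
  have len: "aff_length \<Delta> \<rho> (translation y) = (\<Sum>\<beta>\<in>\<Phi>. nat \<lfloor>\<beta> \<bullet> y\<rfloor>)" if "y \<in> translation_lattice" for y
    using card_inversions[OF translation_word[OF that]] sum_inversions_translation[OF that, of "\<lambda>_. 1 :: nat"]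
    by simp
  show ?thesis
    using sum_roots_uminus[of "\<lambda>\<beta>. nat \<lfloor>\<beta> \<bullet> x\<rfloor>"] by (simp add: len assms minus_lattice)
qed

text \<open>The inversion set determines the positive part of \<open>\<beta> \<bullet> x\<close> for
  every root; taken at \<open>\<beta>\<close> and \<open>- \<beta>\<close>, these determine the
  product itself.\<close>

lemma translation_eqI:
  assumes "x \<in> translation_lattice" "y \<in> translation_lattice"
    and "inversions \<Phi> \<Delta> (translation x) = inversions \<Phi> \<Delta> (translation y)"
  shows "x = y"
proof (rule inner_roots_eqI)
  have "nat \<lfloor>\<beta> \<bullet> x\<rfloor> = nat \<lfloor>\<beta> \<bullet> y\<rfloor>" if "\<beta> \<in> \<Phi>" for \<beta>
  proof -
    have "root_at \<beta> i \<in> inversions \<Phi> \<Delta> (translation z) \<longleftrightarrow> i < nat \<lfloor>\<beta> \<bullet> z\<rfloor>"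
      if "z \<in> translation_lattice" for i z
      using \<open>\<beta> \<in> \<Phi>\<close> unfolding inversions_translation[OF that] by auto
    then show ?thesis
      using assms by (metis linorder_neq_iff less_irrefl)
  qed
  moreover fix \<beta> assume \<beta>: "\<beta> \<in> \<Phi>"
  moreover have "\<beta> \<bullet> x \<in> \<int>" "\<beta> \<bullet> y \<in> \<int>"
    using assms \<beta> inner_lattice_integer by auto
  ultimately have "nat \<lfloor>\<beta> \<bullet> x\<rfloor> = nat \<lfloor>\<beta> \<bullet> y\<rfloor>" "nat \<lfloor>- (\<beta> \<bullet> x)\<rfloor> = nat \<lfloor>- (\<beta> \<bullet> y)\<rfloor>"
    using minus_root[OF \<beta>] by (metis inner_minus_left)+
  with \<open>\<beta> \<bullet> x \<in> \<int>\<close> \<open>\<beta> \<bullet> y \<in> \<int>\<close> show "\<beta> \<bullet> x = \<beta> \<bullet> y"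
    by (auto elim!: Ints_cases)
qed

section \<open>Closed and coclosed sets of roots\<close>

text \<open>The multiple \<open>k\<close> is allowed so that closure under reflections follows
  directly, without root strings; \<open>k = 1\<close> is closure under addition.\<close>

definition closed_subset :: "'a set \<Rightarrow> bool" where
  "closed_subset A \<longleftrightarrow> A \<subseteq> \<Phi> \<and> (\<forall>\<alpha>\<in>A. \<forall>\<beta>\<in>A. \<forall>k::nat. \<alpha> + real k *\<^sub>R \<beta> \<in> \<Phi> \<longrightarrow> \<alpha> + real k *\<^sub>R \<beta> \<in> A)"

lemma closed_subset_add: "closed_subset A \<Longrightarrow> \<alpha> \<in> A \<Longrightarrow> \<beta> \<in> A \<Longrightarrow> \<alpha> + \<beta> \<in> \<Phi> \<Longrightarrow> \<alpha> + \<beta> \<in> A"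
  unfolding closed_subset_def by (metis of_nat_1 scaleR_one)

text \<open>The reflection adds an integer multiple of \<open>\<beta>\<close>; since both
  \<open>\<beta>\<close> and \<open>- \<beta>\<close> lie in \<open>A\<close>, it is a natural
  multiple of one of them.\<close>

lemma closed_subset_reflection:
  assumes A: "closed_subset A" and "\<alpha> \<in> A" "\<beta> \<in> A" "- \<beta> \<in> A"
  shows "fin_reflection \<beta> \<alpha> \<in> A"
proof -
  have \<Phi>: "\<alpha> \<in> \<Phi>" "\<beta> \<in> \<Phi>"
    using assms by (auto simp: closed_subset_def)
  then have root: "fin_reflection \<beta> \<alpha> \<in> \<Phi>"
    by (simp add: fin_reflection_root)
  obtain m :: int where m: "2 * (\<alpha> \<bullet> \<beta>) / (\<beta> \<bullet> \<beta>) = m"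
    using cartan_integer[OF \<Phi>(2,1)] by (auto elim: Ints_cases)
  show ?thesis
  proof (cases "0 \<le> m")
    case True
    then have "fin_reflection \<beta> \<alpha> = \<alpha> + real (nat m) *\<^sub>R (- \<beta>)"
      by (simp add: fin_reflection_def m)
    then show ?thesis
      using A assms root unfolding closed_subset_def by metis
  next
    case False
    then have "fin_reflection \<beta> \<alpha> = \<alpha> + real (nat (- m)) *\<^sub>R \<beta>"
      by (simp add: fin_reflection_def m)
    then show ?thesis
      using A assms root unfolding closed_subset_def by metis
  qed
qed

definition asymmetric_part :: "'a set \<Rightarrow> 'a set" where
  "asymmetric_part A = {\<alpha> \<in> A. - \<alpha> \<notin> A}"

text \<open>If \<open>A\<close> is symmetric, a root of \<open>A\<close> and one outside cannot have
  a negative product: their sum would be a root, and subtracting one of the summands would move the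
  other across the partition. Changing signs makes them orthogonal, against irreducibility.\<close>

lemma asymmetric_part_nonempty:
  assumes A: "closed_subset A" and A': "closed_subset (\<Phi> - A)" and ne: "A \<noteq> {}" "A \<noteq> \<Phi>"
  shows "asymmetric_part A \<noteq> {}"
proof
  assume "asymmetric_part A = {}"
  then have sym: "- \<alpha> \<in> A \<longleftrightarrow> \<alpha> \<in> A" for \<alpha>
    by (auto simp: asymmetric_part_def)
  have sub: "A \<subseteq> \<Phi>"
    using A by (simp add: closed_subset_def)
  have nonneg: "0 \<le> \<alpha> \<bullet> \<beta>" if \<alpha>: "\<alpha> \<in> A" and \<beta>: "\<beta> \<in> \<Phi> - A" for \<alpha> \<beta>
  proof (rule ccontr)
    assume "\<not> 0 \<le> \<alpha> \<bullet> \<beta>"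
    moreover have "\<alpha> \<noteq> - \<beta>"
      using \<alpha> \<beta> sym by auto
    ultimately have root: "\<alpha> + \<beta> \<in> \<Phi>"
      using root_add \<alpha> \<beta> sub by force
    show False
    proof (cases "\<alpha> + \<beta> \<in> A")
      case True
      then show False
        using closed_subset_add[OF A True, of "- \<alpha>"] \<alpha> \<beta> sym by simp
    next
      case False
      then show False
        using closed_subset_add[OF A', of "\<alpha> + \<beta>" "- \<beta>"] root \<alpha> \<beta> sym sub by auto
    qed
  qed
  have "\<alpha> \<bullet> \<beta> = 0" if "\<alpha> \<in> A" "\<beta> \<in> \<Phi> - A" for \<alpha> \<beta>
    using nonneg[OF that] nonneg[of "- \<alpha>" \<beta>] that sym by simp
  then have "\<exists>\<Phi>1 \<Phi>2. \<Phi>1 \<noteq> {} \<and> \<Phi>2 \<noteq> {} \<and> \<Phi> = \<Phi>1 \<union> \<Phi>2 \<and> (\<forall>\<alpha>\<in>\<Phi>1. \<forall>\<beta>\<in>\<Phi>2. \<alpha> \<bullet> \<beta> = 0)"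
    using sub ne by (intro exI[of _ A] exI[of _ "\<Phi> - A"]) auto
  then show False
    using irreducible unfolding irreducible_roots_def by (elim conjE notE)
qed

lemma asymmetric_part_add:
  assumes A: "closed_subset A" and "\<alpha> \<in> asymmetric_part A" "\<beta> \<in> asymmetric_part A" "\<alpha> + \<beta> \<in> \<Phi>"
  shows "\<alpha> + \<beta> \<in> asymmetric_part A"
proof -
  have \<alpha>: "\<alpha> \<in> A" "- \<alpha> \<notin> A" "- \<alpha> \<in> \<Phi>" and \<beta>: "\<beta> \<in> A"
    using assms by (auto simp: asymmetric_part_def closed_subset_def)
  have "- (\<alpha> + \<beta>) \<notin> A"
    using closed_subset_add[OF A _ \<beta>, of "- (\<alpha> + \<beta>)"] \<alpha> by auto
  then show ?thesis
    using closed_subset_add A \<alpha> \<beta> assms(4) by (simp add: asymmetric_part_def)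
qed

text \<open>If the sum is zero, the head has negative product with some other entry. Replacing the
  two by their sum keeps the total and shortens the list. Lists rather than sets are used since the
  merging may create repetitions.\<close>

lemma sum_list_asymmetric_part_nonzero:
  assumes A: "closed_subset A"
  shows "xs \<noteq> [] \<Longrightarrow> set xs \<subseteq> asymmetric_part A \<Longrightarrow> sum_list xs \<noteq> 0"
proof (induction "length xs" arbitrary: xs rule: less_induct)
  case less
  then obtain \<alpha> ys where xs: "xs = \<alpha> # ys"
    by (cases xs) auto
  have in_roots: "asymmetric_part A \<subseteq> \<Phi>"
    using A by (auto simp: asymmetric_part_def closed_subset_def)
  show ?case
  proof
    assume 0: "sum_list xs = 0"
    have "\<exists>\<beta>\<in>set ys. \<alpha> \<bullet> \<beta> < 0"
    proof (rule ccontr)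
      assume "\<not> ?thesis"
      then have "0 \<le> \<alpha> \<bullet> sum_list ys"
        by (induction ys) (auto simp: inner_add_right)
      moreover have "0 < \<alpha> \<bullet> \<alpha>"
        using inner_root_pos less.prems in_roots xs by auto
      ultimately have "0 < \<alpha> \<bullet> sum_list xs"
        by (simp add: xs inner_add_right del: inner_gt_zero_iff)
      then show False
        by (simp add: 0)
    qed
    then obtain \<beta> where \<beta>: "\<beta> \<in> set ys" "\<alpha> \<bullet> \<beta> < 0"
      by blast
    have mem: "\<alpha> \<in> asymmetric_part A" "\<beta> \<in> asymmetric_part A"
      using less.prems \<beta> xs by auto
    then have "\<alpha> \<noteq> - \<beta>"
      by (auto simp: asymmetric_part_def)
    then have "\<alpha> + \<beta> \<in> asymmetric_part A"
      using asymmetric_part_add A mem root_add \<beta> in_roots by blast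
    then have "sum_list ((\<alpha> + \<beta>) # remove1 \<beta> ys) \<noteq> 0"
      using less.prems \<beta> xs
      by (intro less.hyps) (auto simp: length_remove1 dest: notin_set_remove1 set_remove1_subset[THEN subsetD] length_pos_if_in_set)
    then show False
      using 0 sum_list_map_remove1[OF \<beta>(1), of "\<lambda>v. v"] by (simp add: xs add.assoc)
  qed
qed

lemma sum_asymmetric_part_nonzero:
  assumes A: "closed_subset A" and "asymmetric_part A \<noteq> {}"
  shows "\<Sum>(asymmetric_part A) \<noteq> 0"
proof -
  have "finite (asymmetric_part A)"
    using A by (intro finite_subset[OF _ finite_roots]) (auto simp: asymmetric_part_def closed_subset_def)
  then obtain xs where xs: "set xs = asymmetric_part A" "distinct xs"
    using finite_distinct_list by blast
  then have "sum_list xs = \<Sum>(asymmetric_part A)"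
    using sum_list_distinct_conv_sum_set[of xs "\<lambda>v. v"] by simp
  then show ?thesis
    using sum_list_asymmetric_part_nonzero[OF A, of xs] xs assms(2) by (metis empty_set subset_refl)
qed

text \<open>Both \<open>\<beta>\<close> and \<open>- \<beta>\<close> lie in \<open>A\<close> or both
  lie in its complement, so the reflection in \<open>\<beta>\<close> permutes the asymmetric part
  and fixes its sum.\<close>

lemma sum_asymmetric_part_orthogonal:
  assumes A: "closed_subset A" and A': "closed_subset (\<Phi> - A)" and \<beta>: "\<beta> \<in> \<Phi>" "\<beta> \<in> A \<longleftrightarrow> - \<beta> \<in> A"
  shows "\<beta> \<bullet> \<Sum>(asymmetric_part A) = 0"
proof -
  have refl_uminus: "fin_reflection \<beta> (- \<alpha>) = - fin_reflection \<beta> \<alpha>" for \<alpha>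
    by (simp add: fin_reflection_def)
  have sub: "A \<subseteq> \<Phi>"
    using A by (simp add: closed_subset_def)
  have invol: "fin_reflection \<beta> (fin_reflection \<beta> v) = v" for v
    using inner_root_pos[OF \<beta>(1)] by (simp add: fin_reflection_def inner_diff_left algebra_simps)
  have stable: "fin_reflection \<beta> \<alpha> \<in> asymmetric_part A" if "\<alpha> \<in> asymmetric_part A" for \<alpha>
  proof -
    have \<alpha>: "\<alpha> \<in> A" "- \<alpha> \<in> \<Phi> - A"
      using that sub by (auto simp: asymmetric_part_def)
    show ?thesis
    proof (cases "\<beta> \<in> A")
      case True
      \<comment> \<open>Otherwise reflecting back would put \<open>- \<alpha>\<close> into
        \<open>A\<close>.\<close>
      have "- fin_reflection \<beta> \<alpha> \<notin> A"
        using closed_subset_reflection[OF A, of "- fin_reflection \<beta> \<alpha>" \<beta>] True \<beta>(2) \<alpha>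
        by (auto simp: refl_uminus invol)
      then show ?thesis
        using closed_subset_reflection[OF A \<alpha>(1) True] True \<beta>(2) by (simp add: asymmetric_part_def)
    next
      case False
      have "fin_reflection \<beta> (- \<alpha>) \<in> \<Phi> - A"
        using closed_subset_reflection[OF A' \<alpha>(2)] \<beta> False by simp
      moreover have "fin_reflection \<beta> \<alpha> \<in> A"
        using closed_subset_reflection[OF A', of "fin_reflection \<beta> \<alpha>" \<beta>] \<beta> False \<alpha> sub
          fin_reflection_root[OF \<beta>(1)] by (auto simp: invol)
      ultimately show ?thesis
        by (simp add: asymmetric_part_def refl_uminus)
    qed
  qed
  have "fin_reflection \<beta> (\<Sum>(asymmetric_part A)) = (\<Sum>\<alpha>\<in>asymmetric_part A. fin_reflection \<beta> \<alpha>)"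
    by (simp add: fin_reflection_def sum_subtractf inner_sum_left sum_distrib_left sum_divide_distrib
        scaleR_sum_left)
  also have "\<dots> = \<Sum>(asymmetric_part A)"
    by (rule sum.reindex_bij_witness[of _ "fin_reflection \<beta>" "fin_reflection \<beta>"])
      (auto simp: stable invol)
  finally show ?thesis
    using inner_root_pos[OF \<beta>(1)] by (auto simp: fin_reflection_def inner_commute)
qed

section \<open>The growth function and its zeros\<close>

definition growth :: "'a set \<Rightarrow> 'a \<Rightarrow> real" where
  "growth A x = (\<Sum>\<beta>\<in>\<Phi>. (if \<beta> \<in> A then - 1 else 1) * max 0 (\<beta> \<bullet> x))"

lemma growth_scale: "0 \<le> c \<Longrightarrow> growth A (c *\<^sub>R x) = c * growth A x"
proof -
  assume "0 \<le> c"
  then have "max 0 (c * t) = c * max 0 t" for t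
    by (simp add: max_mult_distrib_left)
  then show ?thesis
    by (simp add: growth_def sum_distrib_left mult.left_commute)
qed

lemma growth_lipschitz: "\<bar>growth A x - growth A y\<bar> \<le> (\<Sum>\<beta>\<in>\<Phi>. norm \<beta>) * norm (x - y)"
proof -
  have "\<bar>growth A x - growth A y\<bar> =
      \<bar>\<Sum>\<beta>\<in>\<Phi>. (if \<beta> \<in> A then - 1 else 1) * (max 0 (\<beta> \<bullet> x) - max 0 (\<beta> \<bullet> y))\<bar>"
    by (simp add: growth_def sum_subtractf[symmetric] right_diff_distrib)
  also have "\<dots> \<le> (\<Sum>\<beta>\<in>\<Phi>. norm \<beta> * norm (x - y))"
  proof (rule order_trans[OF sum_abs], rule sum_mono)
    fix \<beta>
    have "\<bar>(if \<beta> \<in> A then - 1 else 1) * (max 0 (\<beta> \<bullet> x) - max 0 (\<beta> \<bullet> y))\<bar> \<le> \<bar>\<beta> \<bullet> (x - y)\<bar>"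
      by (auto simp: inner_diff_right)
    also have "\<dots> \<le> norm \<beta> * norm (x - y)"
      by (rule Cauchy_Schwarz_ineq2)
    finally show "\<bar>(if \<beta> \<in> A then - 1 else 1) * (max 0 (\<beta> \<bullet> x) - max 0 (\<beta> \<bullet> y))\<bar> \<le> norm \<beta> * norm (x - y)" .
  qed
  finally show ?thesis
    by (simp add: sum_distrib_right)
qed

text \<open>Pair \<open>\<beta>\<close> with \<open>- \<beta>\<close>. If exactly one of them is in
  \<open>A\<close>, the two positive parts combine to a linear term; otherwise
  \<open>\<beta>\<close> is orthogonal to the sum and both vanish.\<close>

lemma growth_asymmetric_part:
  assumes A: "closed_subset A" and A': "closed_subset (\<Phi> - A)"
  shows "growth A (s *\<^sub>R \<Sum>(asymmetric_part A)) = - s * (\<Sum>(asymmetric_part A) \<bullet> \<Sum>(asymmetric_part A))"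
proof -
  define l where "l = \<Sum>(asymmetric_part A)"
  define e :: "'a \<Rightarrow> real" where "e \<beta> = (if \<beta> \<in> A then - 1 else 1)" for \<beta>
  define h where "h \<beta> = (if \<beta> \<in> asymmetric_part A then - (\<beta> \<bullet> (s *\<^sub>R l)) else 0)" for \<beta>
  have sub: "asymmetric_part A \<subseteq> \<Phi>"
    using A by (auto simp: asymmetric_part_def closed_subset_def)
  have "e \<beta> * max 0 (\<beta> \<bullet> (s *\<^sub>R l)) + e (- \<beta>) * max 0 ((- \<beta>) \<bullet> (s *\<^sub>R l)) = h \<beta> + h (- \<beta>)"
    if "\<beta> \<in> \<Phi>" for \<beta>
    using sum_asymmetric_part_orthogonal[OF A A' that]
    by (cases "\<beta> \<in> A"; cases "- \<beta> \<in> A") (auto simp: e_def h_def asymmetric_part_def l_def)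
  then have "(\<Sum>\<beta>\<in>\<Phi>. e \<beta> * max 0 (\<beta> \<bullet> (s *\<^sub>R l)) + e (- \<beta>) * max 0 ((- \<beta>) \<bullet> (s *\<^sub>R l))) =
      (\<Sum>\<beta>\<in>\<Phi>. h \<beta> + h (- \<beta>))"
    by (rule sum.cong[OF refl])
  \<comment> \<open>Summing over all roots meets every pair twice, whence the factor 2 on both
    sides.\<close>
  then have "2 * growth A (s *\<^sub>R l) = 2 * (\<Sum>\<beta>\<in>\<Phi>. h \<beta>)"
    using sum_roots_uminus[of h] sum_roots_uminus[of "\<lambda>\<beta>. e \<beta> * max 0 (\<beta> \<bullet> (s *\<^sub>R l))"]
    by (simp add: sum.distrib growth_def e_def)
  also have "(\<Sum>\<beta>\<in>\<Phi>. h \<beta>) = (\<Sum>\<beta>\<in>asymmetric_part A. - (\<beta> \<bullet> (s *\<^sub>R l)))"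
    unfolding h_def by (rule sum.mono_neutral_cong_right[OF finite_roots sub]) auto
  also have "\<dots> = - s * (l \<bullet> l)"
    by (simp add: sum_negf l_def inner_sum_left sum_distrib_left)
  finally show ?thesis
    by (simp add: l_def)
qed

text \<open>In dimension at least 2 the unit sphere is connected, and the normalised sum of the
  asymmetric part and its antipode give values of opposite sign.\<close>

lemma growth_zero:
  assumes A: "closed_subset A" and A': "closed_subset (\<Phi> - A)" and ne: "A \<noteq> {}" "A \<noteq> \<Phi>"
    and dim: "2 \<le> DIM('a)"
  shows "\<exists>z. norm z = 1 \<and> growth A z = 0"
proof -
  define l where "l = \<Sum>(asymmetric_part A)"
  have l: "l \<noteq> 0"
    using sum_asymmetric_part_nonzero[OF A asymmetric_part_nonempty[OF assms(1-4)]] by (simp add: l_def)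
  have "continuous_on (sphere 0 1) (growth A)"
    unfolding growth_def by (intro continuous_intros)
  then have conn: "connected (growth A ` sphere 0 1)"
    using connected_continuous_image connected_sphere[OF dim] by blast
  have "growth A ((1 / norm l) *\<^sub>R l) \<in> growth A ` sphere 0 1"
      "growth A ((- 1 / norm l) *\<^sub>R l) \<in> growth A ` sphere 0 1"
    using l by (intro imageI; simp)+
  moreover have "growth A ((1 / norm l) *\<^sub>R l) \<le> 0" "0 \<le> growth A ((- 1 / norm l) *\<^sub>R l)"
    unfolding l_def growth_asymmetric_part[OF A A'] by simp_all
  ultimately have "0 \<in> growth A ` sphere 0 1"
    using connectedD_interval[OF conn] by blast
  then show ?thesis
    by (auto simp: image_iff)
qed

section \<open>Biclosed sets and twisted orders\<close>

definition cofinal_roots :: "('a \<times> real) set \<Rightarrow> 'a set" where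
  "cofinal_roots C = {\<beta> \<in> \<Phi>. infinite {i. root_at \<beta> i \<in> C}}"

text \<open>Pigeonhole: \<open>C\<close> is spread over the finitely many finite roots.\<close>

lemma cofinal_roots_nonempty:
  assumes "C \<subseteq> aff_pos \<Phi> \<Delta>" "infinite C"
  shows "cofinal_roots C \<noteq> {}"
proof
  assume "cofinal_roots C = {}"
  then have "finite (\<Union>\<beta>\<in>\<Phi>. root_at \<beta> ` {i. root_at \<beta> i \<in> C})"
    using finite_roots by (auto simp: cofinal_roots_def)
  moreover have "C \<subseteq> (\<Union>\<beta>\<in>\<Phi>. root_at \<beta> ` {i. root_at \<beta> i \<in> C})"
  proof
    fix \<gamma> assume \<gamma>: "\<gamma> \<in> C"
    then have "(fst \<gamma>, snd \<gamma>) \<in> aff_pos \<Phi> \<Delta>"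
      using assms by auto
    then obtain i where "fst \<gamma> \<in> \<Phi>" "\<gamma> = root_at (fst \<gamma>) i"
      by (rule aff_pos_cases) simp
    then show "\<gamma> \<in> (\<Union>\<beta>\<in>\<Phi>. root_at \<beta> ` {i. root_at \<beta> i \<in> C})"
      using \<gamma> by (metis (mono_tags, lifting) UN_I imageI mem_Collect_eq)
  qed
  ultimately show False
    using assms finite_subset by blast
qed

lemma closed_roots_combination:
  assumes "closed_roots \<Phi> \<Delta> C" "\<alpha> \<in> C" "\<beta> \<in> C" "0 \<le> k1" "0 \<le> k2"
    and "k1 *\<^sub>R \<alpha> + k2 *\<^sub>R \<beta> \<in> aff_roots \<Phi> \<Delta>"
  shows "k1 *\<^sub>R \<alpha> + k2 *\<^sub>R \<beta> \<in> C"
  using assms unfolding closed_roots_def by blast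

lemma cofinal_rootsD:
  assumes C: "closed_roots \<Phi> \<Delta> C" and \<beta>: "\<beta> \<in> cofinal_roots C"
  shows "\<exists>M. \<forall>i\<ge>M. root_at \<beta> i \<in> C"
proof -
  \<comment> \<open>\<open>root_at \<beta> i\<close> is a convex combination of \<open>root_at \<beta> M\<close> and \<open>root_at \<beta> j\<close> for \<open>M \<le> i \<le> j\<close>\<close>
  have \<beta>\<Phi>: "\<beta> \<in> \<Phi>" and inf: "infinite {i. root_at \<beta> i \<in> C}"
    using \<beta> by (auto simp: cofinal_roots_def)
  obtain M where M: "root_at \<beta> M \<in> C"
    using inf by (metis (mono_tags, lifting) Collect_empty_eq finite.emptyI)
  have "root_at \<beta> i \<in> C" if "M \<le> i" for i
  proof (cases "i = M")
    case False
    obtain j where j: "i < j" "root_at \<beta> j \<in> C"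
      using inf unfolding infinite_nat_iff_unbounded by blast
    define d where "d = real j - real M"
    define k1 k2 where "k1 = (real j - real i) / d" and "k2 = (real i - real M) / d"
    have d: "0 < d"
      using that j by (simp add: d_def)
    have sum: "k1 + k2 = 1"
      using d by (simp add: k1_def k2_def add_divide_distrib[symmetric]) (simp add: d_def)
    have "k1 * real M + k2 * real j = (k1 + k2) * real M + k2 * d"
      by (simp add: d_def algebra_simps)
    also have "\<dots> = real i"
      using d sum by (simp add: k2_def)
    finally have "k1 * real M + k2 * real j = real i" .
    then have "k1 *\<^sub>R root_at \<beta> M + k2 *\<^sub>R root_at \<beta> j = root_at \<beta> i"
      using sum by (auto simp: root_at_def scaleR_add_left[symmetric] algebra_simps)
    then show ?thesis
      using closed_roots_combination[OF C M j(2), of k1 k2] root_at_pos[OF \<beta>\<Phi>] aff_pos_roots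
      using that j d by (simp add: k1_def k2_def)
  qed (use M in simp)
  then show ?thesis
    by blast
qed

text \<open>Adding \<open>k\<close> times one root of \<open>C\<close> over \<open>\<beta>\<close>
  to roots of \<open>C\<close> arbitrarily high over \<open>\<alpha>\<close> gives arbitrarily high
  roots of \<open>C\<close> over the combination.\<close>

lemma cofinal_roots_closed:
  assumes C: "closed_roots \<Phi> \<Delta> C" and pos: "C \<subseteq> aff_pos \<Phi> \<Delta>"
  shows "closed_subset (cofinal_roots C)"
  unfolding closed_subset_def
proof (intro conjI ballI allI impI)
  show "cofinal_roots C \<subseteq> \<Phi>"
    by (auto simp: cofinal_roots_def)
  fix \<alpha> \<beta> and k :: nat
  assume \<alpha>: "\<alpha> \<in> cofinal_roots C" and \<beta>: "\<beta> \<in> cofinal_roots C" and root: "\<alpha> + real k *\<^sub>R \<beta> \<in> \<Phi>"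
  obtain M N where M: "\<forall>i\<ge>M. root_at \<alpha> i \<in> C" and N: "\<forall>i\<ge>N. root_at \<beta> i \<in> C"
    using cofinal_rootsD[OF C] \<alpha> \<beta> by metis
  have "\<exists>j>m. root_at (\<alpha> + real k *\<^sub>R \<beta>) j \<in> C" for m
  proof -
    \<comment> \<open>The level is at least \<open>m + 2\<close>: one unit covers the offset of
      \<open>root_at\<close>, the other makes the index exceed \<open>m\<close>.\<close>
    define \<gamma> where "\<gamma> = 1 *\<^sub>R root_at \<alpha> (M + m + 2) + real k *\<^sub>R root_at \<beta> N"
    have fst: "fst \<gamma> = \<alpha> + real k *\<^sub>R \<beta>" and snd: "real m + 2 \<le> snd \<gamma>" "snd \<gamma> \<in> \<int>"
      by (auto simp: \<gamma>_def root_at_def)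
    then have "\<gamma> \<in> aff_roots \<Phi> \<Delta>"
      using root by (metis aff_roots_iff prod.collapse)
    then have \<gamma>: "\<gamma> \<in> C"
      unfolding \<gamma>_def using M N by (intro closed_roots_combination[OF C]) auto
    then have "(\<alpha> + real k *\<^sub>R \<beta>, snd \<gamma>) \<in> aff_pos \<Phi> \<Delta>"
      using pos fst by (metis prod.collapse subsetD)
    then obtain j where j: "(\<alpha> + real k *\<^sub>R \<beta>, snd \<gamma>) = root_at (\<alpha> + real k *\<^sub>R \<beta>) j"
      by (rule aff_pos_cases)
    then have "real m < real j"
      using snd by (auto simp: root_at_def split: if_splits)
    then show ?thesis
      using j \<gamma> fst by (metis of_nat_less_iff prod.collapse)
  qed
  then show "\<alpha> + real k *\<^sub>R \<beta> \<in> cofinal_roots C"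
    using root by (simp add: cofinal_roots_def infinite_nat_iff_unbounded)
qed

text \<open>Containing infinitely many roots over \<open>\<beta>\<close> means containing almost all
  of them, so exactly one of \<open>B\<close> and its complement does.\<close>

lemma cofinal_roots_complement:
  assumes "biclosed \<Phi> \<Delta> B"
  shows "cofinal_roots (aff_pos \<Phi> \<Delta> - B) = \<Phi> - cofinal_roots B"
proof -
  have B: "closed_roots \<Phi> \<Delta> B"
    using assms by (auto simp: biclosed_def)
  have "infinite {i. root_at \<beta> i \<in> aff_pos \<Phi> \<Delta> - B} \<longleftrightarrow> finite {i. root_at \<beta> i \<in> B}" if "\<beta> \<in> \<Phi>" for \<beta>
  proof
    assume inf: "infinite {i. root_at \<beta> i \<in> aff_pos \<Phi> \<Delta> - B}"
    show "finite {i. root_at \<beta> i \<in> B}"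
    proof (rule ccontr)
      assume "infinite {i. root_at \<beta> i \<in> B}"
      then obtain M where M: "\<forall>i\<ge>M. root_at \<beta> i \<in> B"
        using cofinal_rootsD[OF B] \<open>\<beta> \<in> \<Phi>\<close> by (auto simp: cofinal_roots_def)
      obtain j where "M < j" "root_at \<beta> j \<notin> B"
        using inf unfolding infinite_nat_iff_unbounded by blast
      then show False
        using M by simp
    qed
  next
    assume "finite {i. root_at \<beta> i \<in> B}"
    moreover have "{i. root_at \<beta> i \<in> aff_pos \<Phi> \<Delta> - B} = - {i. root_at \<beta> i \<in> B}"
      using root_at_pos[OF that] by auto
    ultimately show "infinite {i. root_at \<beta> i \<in> aff_pos \<Phi> \<Delta> - B}"
      by (simp add: finite_compl)
  qed
  then show ?thesis
    by (auto simp: cofinal_roots_def)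
qed

section \<open>Signed counts of inversions\<close>

definition signed_card :: "('a \<times> real) set \<Rightarrow> ('a \<times> real) set \<Rightarrow> int" where
  "signed_card B N = (\<Sum>\<gamma>\<in>N. if \<gamma> \<in> B then - 1 else 1)"

lemma signed_card_eq:
  assumes "finite N"
  shows "signed_card B N = int (card N) - 2 * int (card (N \<inter> B))"
proof -
  have "signed_card B N = (\<Sum>\<gamma>\<in>N. 1 - 2 * (if \<gamma> \<in> B then 1 else 0))"
    unfolding signed_card_def by (rule sum.cong) auto
  also have "\<dots> = int (card N) - 2 * (\<Sum>\<gamma>\<in>N. if \<gamma> \<in> B then 1 else 0)"
    by (simp only: sum_subtractf sum_distrib_left[symmetric]) simp
  also have "(\<Sum>\<gamma>\<in>N. if \<gamma> \<in> B then 1 else 0) = int (card (N \<inter> B))"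
    using assms by (simp add: sum.inter_restrict[symmetric])
  finally show ?thesis .
qed

text \<open>Passing from \<open>M\<close> to \<open>N\<close> removes elements of \<open>B\<close>
  and adds elements outside \<open>B\<close>. Each such change raises the signed count by one, so
  equal counts leave no change.\<close>

lemma signed_card_eq_imp_eq:
  assumes fin: "finite M" "finite N" and sub: "M - N \<subseteq> B" "(N - M) \<inter> B = {}"
    and eq: "signed_card B M = signed_card B N"
  shows "M = N"
proof -
  have "signed_card B M = signed_card B (M \<inter> N) + signed_card B (M - N)"
    "signed_card B N = signed_card B (M \<inter> N) + signed_card B (N - M)"
    unfolding signed_card_def using sum.Int_Diff[OF fin(1), of _ N] sum.Int_Diff[OF fin(2), of _ M]
    by (auto simp: Int_commute)
  moreover have "signed_card B (M - N) = - int (card (M - N))"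
    unfolding signed_card_def using sub by (subst sum.cong[OF refl, of _ _ "\<lambda>_. - 1"]) auto
  moreover have "signed_card B (N - M) = int (card (N - M))"
    unfolding signed_card_def using sub by (subst sum.cong[OF refl, of _ _ "\<lambda>_. 1"]) auto
  ultimately have "card (M - N) = 0" "card (N - M) = 0"
    using eq by linarith+
  then show ?thesis
    using fin by auto
qed

text \<open>Over each \<open>\<beta>\<close>, membership in \<open>B\<close> is constant from some
  index \<open>M \<beta>\<close> on. Replacing the actual signs by the eventual one therefore
  changes at most \<open>M \<beta>\<close> terms, each by at most 2.\<close>

lemma signed_card_translation:
  assumes B: "biclosed \<Phi> \<Delta> B"
  shows "\<exists>C. \<forall>x\<in>translation_lattice.
    \<bar>real_of_int (signed_card B (inversions \<Phi> \<Delta> (translation x))) - growth (cofinal_roots B) x\<bar> \<le> C"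
proof -
  define e :: "'a \<Rightarrow> real" where "e \<beta> = (if \<beta> \<in> cofinal_roots B then - 1 else 1)" for \<beta>
  define b :: "'a \<Rightarrow> nat \<Rightarrow> real" where "b \<beta> i = (if root_at \<beta> i \<in> B then - 1 else 1)" for \<beta> i
  have closed: "closed_roots \<Phi> \<Delta> B" "closed_roots \<Phi> \<Delta> (aff_pos \<Phi> \<Delta> - B)"
    using B by (auto simp: biclosed_def)
  have "\<exists>M. \<forall>i\<ge>M. b \<beta> i = e \<beta>" if "\<beta> \<in> \<Phi>" for \<beta>
  proof (cases "\<beta> \<in> cofinal_roots B")
    case True
    then show ?thesis
      using cofinal_rootsD[OF closed(1) True] by (auto simp: b_def e_def)
  next
    case False
    then have "\<beta> \<in> cofinal_roots (aff_pos \<Phi> \<Delta> - B)"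
      using cofinal_roots_complement[OF B] that by simp
    then show ?thesis
      using cofinal_rootsD[OF closed(2)] False by (fastforce simp: b_def e_def)
  qed
  then obtain M where M: "\<And>\<beta> i. \<beta> \<in> \<Phi> \<Longrightarrow> M \<beta> \<le> i \<Longrightarrow> b \<beta> i = e \<beta>"
    by metis
  have bound: "\<bar>(\<Sum>i<m. b \<beta> i) - e \<beta> * real m\<bar> \<le> 2 * real (M \<beta>)" if "\<beta> \<in> \<Phi>" for \<beta> m
  proof -
    have "(\<Sum>i<m. b \<beta> i) - e \<beta> * real m = (\<Sum>i<m. b \<beta> i - e \<beta>)"
      by (simp add: sum_subtractf)
    also have "\<bar>\<dots>\<bar> \<le> (\<Sum>i<m. if i < M \<beta> then 2 else 0)"
      using M[OF that] by (intro order_trans[OF sum_abs] sum_mono) (auto simp: b_def e_def not_less)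
    also have "\<dots> = 2 * real (card ({..<m} \<inter> {..<M \<beta>}))"
      by (simp add: sum.If_cases lessThan_def)
    also have "\<dots> \<le> 2 * real (M \<beta>)"
      using card_mono[of "{..<M \<beta>}" "{..<m} \<inter> {..<M \<beta>}"] by simp
    finally show ?thesis .
  qed
  have "\<bar>real_of_int (signed_card B (inversions \<Phi> \<Delta> (translation x))) - growth (cofinal_roots B) x\<bar>
      \<le> (\<Sum>\<beta>\<in>\<Phi>. 2 * real (M \<beta>))" if x: "x \<in> translation_lattice" for x
  proof -
    have "real_of_int (signed_card B (inversions \<Phi> \<Delta> (translation x))) =
        (\<Sum>\<gamma>\<in>inversions \<Phi> \<Delta> (translation x). if \<gamma> \<in> B then - 1 else 1)"
      unfolding signed_card_def of_int_sum by (rule sum.cong) auto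
    then have 1: "real_of_int (signed_card B (inversions \<Phi> \<Delta> (translation x))) =
        (\<Sum>\<beta>\<in>\<Phi>. \<Sum>i<nat \<lfloor>\<beta> \<bullet> x\<rfloor>. b \<beta> i)"
      by (simp add: sum_inversions_translation[OF x] b_def)
    have "max 0 (\<beta> \<bullet> x) = real (nat \<lfloor>\<beta> \<bullet> x\<rfloor>)" if "\<beta> \<in> \<Phi>" for \<beta>
      using inner_lattice_integer[OF x that] by (auto elim!: Ints_cases simp: max_def)
    then have 2: "growth (cofinal_roots B) x = (\<Sum>\<beta>\<in>\<Phi>. e \<beta> * real (nat \<lfloor>\<beta> \<bullet> x\<rfloor>))"
      unfolding growth_def e_def by (intro sum.cong) simp_all
    show ?thesis
      unfolding 1 2 sum_subtractf[symmetric]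
      by (rule order_trans[OF sum_abs sum_mono]) (rule bound)
  qed
  then show ?thesis
    by blast
qed

text \<open>Lattice points within distance \<open>D\<close> of the multiples of \<open>z\<close>
  have growth at most \<open>K * D\<close> in absolute value by the Lipschitz bound, and they are
  unbounded.\<close>

lemma infinite_bounded_growth:
  assumes z: "norm z = 1" "growth A z = 0"
  shows "\<exists>C. infinite {x \<in> translation_lattice. \<bar>growth A x\<bar> \<le> C}"
proof -
  define K where "K = (\<Sum>\<beta>\<in>\<Phi>. norm \<beta>)"
  obtain D where D: "\<And>v. \<exists>x\<in>translation_lattice. norm (v - x) \<le> D"
    using lattice_dense by blast
  have "0 \<le> K"
    by (simp add: K_def sum_nonneg)
  define X where "X = {x \<in> translation_lattice. \<bar>growth A x\<bar> \<le> K * D}"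
  have "infinite X"
  proof
    assume "finite X"
    then have "bounded X"
      by (rule finite_imp_bounded)
    then obtain R where R: "\<forall>x\<in>X. norm x \<le> R"
      by (auto simp: bounded_iff)
    obtain n :: nat where n: "R + D < real n"
      using reals_Archimedean2 by blast
    obtain x where x: "x \<in> translation_lattice" "norm (real n *\<^sub>R z - x) \<le> D"
      using D by blast
    have "\<bar>growth A x\<bar> = \<bar>growth A (real n *\<^sub>R z) - growth A x\<bar>"
      using growth_scale[of "real n" A z] z by simp
    also have "\<dots> \<le> K * norm (real n *\<^sub>R z - x)"
      unfolding K_def by (rule growth_lipschitz)
    also have "\<dots> \<le> K * D"
      using x \<open>0 \<le> K\<close> by (intro mult_left_mono)
    finally have "x \<in> X"
      using x by (simp add: X_def)
    then have "norm x \<le> R"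
      using R by blast
    moreover have "real n \<le> norm (real n *\<^sub>R z - x) + norm x"
      using norm_triangle_ineq[of "real n *\<^sub>R z - x" x] z by simp
    ultimately show False
      using n x by linarith
  qed
  then show ?thesis
    by (auto simp: X_def)
qed

lemma infinite_signed_card_level:
  assumes B: "biclosed \<Phi> \<Delta> B" "infinite B" "infinite (aff_pos \<Phi> \<Delta> - B)" and dim: "2 \<le> DIM('a)"
  obtains X c where "infinite X" "X \<subseteq> translation_lattice"
    "\<And>x. x \<in> X \<Longrightarrow> signed_card B (inversions \<Phi> \<Delta> (translation x)) = c"
proof -
  define A where "A = cofinal_roots B"
  define S where "S x = signed_card B (inversions \<Phi> \<Delta> (translation x))" for x
  have closed: "closed_subset A" "closed_subset (\<Phi> - A)"
    using cofinal_roots_closed[of B] cofinal_roots_closed[of "aff_pos \<Phi> \<Delta> - B"] B(1)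
      cofinal_roots_complement[OF B(1)] by (auto simp: A_def biclosed_def)
  have "A \<noteq> {}" "\<Phi> - A \<noteq> {}"
    using cofinal_roots_nonempty[of B] cofinal_roots_nonempty[of "aff_pos \<Phi> \<Delta> - B"] B
      cofinal_roots_complement[OF B(1)] by (auto simp: A_def biclosed_def)
  then obtain z where z: "norm z = 1" "growth A z = 0"
    using growth_zero[OF closed _ _ dim] by blast
  obtain C where C: "infinite {x \<in> translation_lattice. \<bar>growth A x\<bar> \<le> C}"
    using infinite_bounded_growth z by blast
  define Y where "Y = {x \<in> translation_lattice. \<bar>growth A x\<bar> \<le> C}"
  obtain C' where C': "\<And>x. x \<in> translation_lattice \<Longrightarrow> \<bar>real_of_int (S x) - growth A x\<bar> \<le> C'"
    using signed_card_translation[OF B(1)] unfolding A_def S_def by blast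
  have "S ` Y \<subseteq> {- \<lceil>C + C'\<rceil>..\<lceil>C + C'\<rceil>}"
  proof
    fix s assume "s \<in> S ` Y"
    then obtain x where x: "x \<in> Y" "s = S x"
      by blast
    then have "\<bar>real_of_int s\<bar> \<le> C + C'"
      using C'[of x] by (auto simp: Y_def)
    also have "\<dots> \<le> real_of_int \<lceil>C + C'\<rceil>"
      by (rule le_of_int_ceiling)
    finally show "s \<in> {- \<lceil>C + C'\<rceil>..\<lceil>C + C'\<rceil>}"
      by (simp add: abs_le_iff)
  qed
  then have "finite (S ` Y)"
    using finite_subset by blast
  then obtain x0 where "infinite {x \<in> Y. S x = S x0}"
    using pigeonhole_infinite[of Y S] C by (auto simp: Y_def)
  then show ?thesis
    by (rule that) (auto simp: Y_def S_def)
qed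

lemma translation_inj: "translation x = translation y \<Longrightarrow> x = y"
proof -
  assume eq: "translation x = translation y"
  have "\<beta> \<bullet> x = \<beta> \<bullet> y" for \<beta>
    using fun_cong[OF eq, of "(\<beta>, 0)"] by (simp add: translation_def)
  then show "x = y"
    by (rule inner_roots_eqI)
qed

section \<open>Antichains of translations\<close>

lemma weak_antichain:
  assumes X: "X \<subseteq> translation_lattice"
    and level: "\<And>x. x \<in> X \<Longrightarrow> signed_card B (inversions \<Phi> \<Delta> (translation x)) = c"
  shows "antichain_in (aff_weyl \<Phi> \<Delta>) (twisted_weak_le \<Phi> \<Delta> B) (translation ` X)"
  unfolding antichain_in_def
proof (intro conjI ballI impI notI)
  show "translation ` X \<subseteq> aff_weyl \<Phi> \<Delta>"
    using X by (auto simp: translation_lattice_def)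
  fix u v assume uv: "u \<in> translation ` X" "v \<in> translation ` X" "u \<noteq> v" "twisted_weak_le \<Phi> \<Delta> B u v"
  then obtain x y where xy: "x \<in> X" "y \<in> X" "u = translation x" "v = translation y"
    by auto
  then have fin: "finite (inversions \<Phi> \<Delta> u)" "finite (inversions \<Phi> \<Delta> v)"
    using X card_inversions translation_word by blast+
  have "inversions \<Phi> \<Delta> u = inversions \<Phi> \<Delta> v"
    using uv(4) level xy by (intro signed_card_eq_imp_eq[OF fin, of B]) (auto simp: twisted_weak_le_def)
  then show False
    using translation_eqI[of x y] X xy uv(3) by auto
qed

lemma twisted_strong_le_eq:
  assumes "twisted_strong_le \<Phi> \<Delta> \<rho> B u v" "twisted_length \<Phi> \<Delta> \<rho> B u = twisted_length \<Phi> \<Delta> \<rho> B v"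
  shows "u = v"
proof -
  have "u = v \<or> twisted_length \<Phi> \<Delta> \<rho> B u < twisted_length \<Phi> \<Delta> \<rho> B v"
    using assms(1) unfolding twisted_strong_le_def
    by (induction rule: rtranclp_induct) (auto simp: twisted_strong_step_def)
  then show ?thesis
    using assms(2) by simp
qed

text \<open>The twisted length counts inversions of the inverse element, so the translation by
  \<open>- x\<close> is matched with the inversions of the translation by \<open>x\<close>.\<close>

lemma twisted_length_translation:
  assumes x: "x \<in> translation_lattice"
  shows "twisted_length \<Phi> \<Delta> \<rho> B (translation (- x)) = signed_card B (inversions \<Phi> \<Delta> (translation x))"
  using card_inversions[OF translation_word[OF x]]
  by (simp add: twisted_length_def inv_translation aff_length_translation_minus[OF x] signed_card_eq)

lemma strong_antichain:
  assumes X: "X \<subseteq> translation_lattice"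
    and level: "\<And>x. x \<in> X \<Longrightarrow> signed_card B (inversions \<Phi> \<Delta> (translation x)) = c"
  shows "antichain_in (aff_weyl \<Phi> \<Delta>) (twisted_strong_le \<Phi> \<Delta> \<rho> B) (translation ` uminus ` X)"
  unfolding antichain_in_def
proof (intro conjI ballI impI notI)
  show "translation ` uminus ` X \<subseteq> aff_weyl \<Phi> \<Delta>"
    using X minus_lattice by (auto simp: translation_lattice_def)
  fix u v assume uv: "u \<in> translation ` uminus ` X" "v \<in> translation ` uminus ` X" "u \<noteq> v"
    and le: "twisted_strong_le \<Phi> \<Delta> \<rho> B u v"
  have "twisted_length \<Phi> \<Delta> \<rho> B u = c" "twisted_length \<Phi> \<Delta> \<rho> B v = c"
    using uv X level by (auto simp: twisted_length_translation subset_iff)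
  then show False
    using twisted_strong_le_eq[OF le] uv(3) by simp
qed

text \<open>Linear independence bounds the size of \<open>\<Delta>\<close> by the dimension, and
  there is one further simple root.\<close>

lemma aff_rank_le: "aff_rank \<Delta> \<rho> \<le> DIM('a) + 1"
proof -
  have "aff_rank \<Delta> \<rho> \<le> card (aff_simple_roots \<Delta> \<rho>)"
    unfolding aff_rank_def simple_reflections_def
    by (rule card_image_le) (simp add: aff_simple_roots_def finite_base)
  also have "\<dots> \<le> card ((\<lambda>\<alpha>. (\<alpha>, 0 :: real)) ` \<Delta>) + 1"
    using card_Un_le[of "(\<lambda>\<alpha>. (\<alpha>, 0 :: real)) ` \<Delta>" "{(- \<rho>, 1)}"] by (simp add: aff_simple_roots_def)
  also have "\<dots> \<le> card \<Delta> + 1"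
    using card_image_le[OF finite_base] by simp
  also have "card \<Delta> \<le> DIM('a)"
    using independent_bound independent_base by blast
  finally show ?thesis
    by simp
qed

end

theorem corollary5p6:
  fixes \<Phi> \<Delta> :: "'a::euclidean_space set" and \<rho> :: 'a and B :: "('a \<times> real) set"
  assumes "crystallographic_root_system \<Phi>"
    and "irreducible_roots \<Phi>"
    and "simple_system \<Phi> \<Delta>"
    and "highest_root \<Phi> \<Delta> \<rho>"
    and "aff_rank \<Delta> \<rho> \<ge> 3"
    and "biclosed \<Phi> \<Delta> B"
    and "infinite B"
    and "infinite (aff_pos \<Phi> \<Delta> - B)"
  shows "(\<exists>A. infinite A \<and> antichain_in (aff_weyl \<Phi> \<Delta>) (twisted_weak_le \<Phi> \<Delta> B) A) \<and>
    (\<exists>A. infinite A \<and> antichain_in (aff_weyl \<Phi> \<Delta>) (twisted_strong_le \<Phi> \<Delta> \<rho> B) A)"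
proof -
  interpret based_root_system \<Phi> \<Delta> \<rho>
    using assms by unfold_locales
  \<comment> \<open>This is where the rank enters: it makes the unit sphere connected.\<close>
  have "2 \<le> DIM('a)"
    using aff_rank_le assms(5) by linarith
  from infinite_signed_card_level[OF assms(6-8) this]
  obtain X c where X: "infinite X" "X \<subseteq> translation_lattice"
    and level: "\<And>x. x \<in> X \<Longrightarrow> signed_card B (inversions \<Phi> \<Delta> (translation x)) = c"
    by blast
  have inj: "inj_on translation Y" for Y
    using translation_inj by (blast intro: inj_onI)
  have "infinite (translation ` X)" "infinite (translation ` uminus ` X)"
    using X(1) by (simp_all add: finite_image_iff inj)
  then show ?thesis
    using weak_antichain[OF X(2) level] strong_antichain[OF X(2) level] by blast
qed

end
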